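(* Let $N\ge1$, $s\in(0,1)$ and let $\Omega\subsetneq\mathbb R^N$ be a non-empty open set. For any measurable set $E\subseteq\Omega$ let $$P_s(E)=[\mathbf 1_E]_{W^{s,1}(\mathbb R^N)}\quad\text{and}\quad V_{s,\Omega}(E)=\int_E\frac{1}{d_\Omega^s}\,dx.$$ Then $$\mathfrak h_{s,1}(\Omega)=\mathfrak g_s(\Omega),$$ where $$\mathfrak g_s(\Omega)=\inf\Big\{\frac{P_s(E)}{V_{s,\Omega}(E)}: E\Subset\Omega,\ |E|>0\Big\}\in[0,\infty).$$
   Context: For a non-empty open set $\Omega\subsetneq\mathbb R^N$ and $x\in\Omega$, $d_\Omega(x)=\inf_{y\in\partial\Omega}|x-y|$. $C^\infty_0(\Omega)$ is the set of smooth real functions on $\mathbb R^N$ with compact support contained in $\Omega$. For $s\in(0,1)$ and measurable $u$ on $\mathbb R^N$, $$[u]_{W^{s,1}(\mathbb R^N)}=\int_{\mathbb R^N}\int_{\mathbb R^N}\frac{|u(x)-u(y)|}{|x-y|^{N+s}}\,dx\,dy\in[0,\infty],$$ $$\mathfrak h_{s,1}(\Omega)=\inf_{u\in C^\infty_0(\Omega)}\Big\{[u]_{W^{s,1}(\mathbb R^N)}:\int_\Omega\frac{|u|}{d_\Omega^s}\,dx=1\Big\}\in[0,\infty).$$ $\mathbf 1_E$ is the indicator function of $E$, $|E|$ its Lebesgue measure, and $E\Subset\Omega$ means that $E$ is measurable and its closure is a compact subset of $\Omega$. *)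

theory Defs
  imports "HOL-Analysis.Analysis"
begin

(* The library has no C^k classes on Euclidean spaces.  Directional derivatives in all
   directions v are taken through the Frechet derivative. *)
primrec k_times_cont_diff :: "nat \<Rightarrow> ('a::euclidean_space \<Rightarrow> real) \<Rightarrow> bool" where
  "k_times_cont_diff 0 f \<longleftrightarrow> continuous_on UNIV f"
| "k_times_cont_diff (Suc k) f \<longleftrightarrow>
     (\<forall>x. f differentiable (at x)) \<and>
     (\<forall>v. k_times_cont_diff k (\<lambda>x. frechet_derivative f (at x) v))"

definition smooth :: "('a::euclidean_space \<Rightarrow> real) \<Rightarrow> bool" where
  "smooth f \<longleftrightarrow> (\<forall>k. k_times_cont_diff k f)"

definition test_functions :: "'a::euclidean_space set \<Rightarrow> ('a \<Rightarrow> real) set" where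
  "test_functions \<Omega> =
     {u. smooth u \<and> compact (closure {x. u x \<noteq> 0}) \<and> closure {x. u x \<noteq> 0} \<subseteq> \<Omega>}"

definition bdist :: "'a::euclidean_space set \<Rightarrow> 'a \<Rightarrow> real" where
  "bdist \<Omega> x = infdist x (frontier \<Omega>)"

(* On the null set x = y the integrand is 0 / 0 = 0. *)
definition gagliardo :: "real \<Rightarrow> ('a::euclidean_space \<Rightarrow> real) \<Rightarrow> ennreal" where
  "gagliardo s u =
     (\<integral>\<^sup>+ y. (\<integral>\<^sup>+ x. ennreal (\<bar>u x - u y\<bar> / norm (x - y) powr (real DIM('a) + s)) \<partial>lebesgue) \<partial>lebesgue)"

definition hardy_const :: "real \<Rightarrow> 'a::euclidean_space set \<Rightarrow> ennreal" where
  "hardy_const s \<Omega> =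
     (INF u \<in> {u \<in> test_functions \<Omega>. (\<integral>\<^sup>+ x\<in>\<Omega>. ennreal (\<bar>u x\<bar> / bdist \<Omega> x powr s) \<partial>lebesgue) = 1}.
        gagliardo s u)"

definition frac_perimeter :: "real \<Rightarrow> 'a::euclidean_space set \<Rightarrow> ennreal" where
  "frac_perimeter s E = gagliardo s (indicator E)"

definition weighted_volume :: "real \<Rightarrow> 'a::euclidean_space set \<Rightarrow> 'a set \<Rightarrow> ennreal" where
  "weighted_volume s \<Omega> E = (\<integral>\<^sup>+ x\<in>E. ennreal (1 / bdist \<Omega> x powr s) \<partial>lebesgue)"

definition compactly_inside :: "'a::euclidean_space set \<Rightarrow> 'a set \<Rightarrow> bool" where
  "compactly_inside E \<Omega> \<longleftrightarrow> E \<in> sets lebesgue \<and> compact (closure E) \<and> closure E \<subseteq> \<Omega>"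

(* The quotients are well defined in ennreal: for open \<Omega> with non-empty boundary and the
   sets E occurring here, the denominator is positive and finite.  The numerator may be
   infinite. *)
definition cheeger_const :: "real \<Rightarrow> 'a::euclidean_space set \<Rightarrow> ennreal" where
  "cheeger_const s \<Omega> =
     (INF E \<in> {E. compactly_inside E \<Omega> \<and> emeasure lebesgue E > 0}.
        frac_perimeter s E / weighted_volume s \<Omega> E)"

end

theory Submission
  imports Defs "HOL-Computational_Algebra.Polynomial"
begin

text \<open>
  Both inequalities compare functions with sets through the indicator function.

  A test function is a superposition of the indicators of its super-level sets
  \<open>{x. t < \<bar>u x\<bar>}\<close>, \<open>t \<ge> 0\<close>. The pointwise layer-cake identity for
  \<open>\<bar>\<bar>u x\<bar> - \<bar>u y\<bar>\<bar>\<close> and Tonelli's theorem turn the Gagliardo seminorm of \<open>\<bar>u\<bar>\<close>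
  into the integral over \<open>t\<close> of the perimeters of these sets (the coarea formula), and the
  weighted integral of \<open>\<bar>u\<bar>\<close> into the integral of their weighted volumes. Each
  non-empty level set competes in the Cheeger problem, and integrating
  \<open>g * V \<le> P\<close> over the levels gives \<open>cheeger_const_le_hardy_const\<close>.

  Conversely, a competitor \<open>E\<close> of the Cheeger problem is regularised by convolution of its
  indicator with a smooth bump \<open>\<rho>\<close> of mass \<open>m\<close> supported in a ball of radius \<open>e\<close>.
  The seminorm is translation invariant and convex, so the convolution has seminorm at most
  \<open>m * P(E)\<close> (\<open>gagliardo_mollify_le\<close>). Moving the translation from the function to the weight
  and using that the distance to the boundary is 1-Lipschitz shows that the weighted integral
  of the convolution is at least \<open>m * (1 + e / r) powr - s * V(E)\<close>, where \<open>r\<close> bounds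
  the distance of \<open>E\<close> to the boundary from below (\<open>weighted_integral_mollify_ge\<close>). The mass
  cancels, and \<open>e \<rightarrow> 0\<close> gives \<open>hardy_const_le_cheeger_quotient\<close>.

  The constants are finite because every smooth function with bounded support has finite
  seminorm (\<open>gagliardo_smooth_finite\<close>): its increments are bounded by a multiple of
  \<open>min 1 \<bar>x - y\<bar>\<close>, and \<open>min 1 \<bar>z\<bar> / \<bar>z\<bar> powr (N + s)\<close> is integrable for \<open>0 < s < 1\<close>.
\<close>

section \<open>Lebesgue measure and the Gagliardo kernel\<close>

lemma emeasure_open_pos:
  fixes S :: "'a::euclidean_space set"
  assumes "open S" "S \<noteq> {}"
  shows "0 < emeasure lborel S"
  using open_not_negligible[OF assms] assms(1)
  by (simp add: negligible_iff_null_sets null_sets_def zero_less_iff_neq_zero)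

lemma nn_integral_lborel_shift:
  fixes f :: "'a::euclidean_space \<Rightarrow> ennreal"
  assumes [measurable]: "f \<in> borel_measurable borel"
  shows "(\<integral>\<^sup>+ x. f (c + x) \<partial>lborel) = (\<integral>\<^sup>+ x. f x \<partial>lborel)"
  by (subst (2) lborel_distr_plus[of c, symmetric]) (simp add: nn_integral_distr)

lemma nn_integral_lborel_reflect:
  fixes f :: "'a::euclidean_space \<Rightarrow> ennreal"
  assumes [measurable]: "f \<in> borel_measurable borel"
  shows "(\<integral>\<^sup>+ x. f (c - x) \<partial>lborel) = (\<integral>\<^sup>+ x. f x \<partial>lborel)"
  by (subst (2) lborel_affine[of "-1" c]) (simp_all add: nn_integral_density nn_integral_distr)

abbreviation gagliardo_kernel :: "real \<Rightarrow> 'a::euclidean_space \<Rightarrow> real" where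
  "gagliardo_kernel s z \<equiv> 1 / norm z powr (real DIM('a) + s)"

text \<open>The iterated integral does not change if the completed measure is replaced by the Borel one,
  where Tonelli's theorem applies on products.\<close>

lemma gagliardo_lborel:
  fixes u :: "'a::euclidean_space \<Rightarrow> real"
  shows "gagliardo s u =
    (\<integral>\<^sup>+ y. (\<integral>\<^sup>+ x. ennreal \<bar>u x - u y\<bar> * ennreal (gagliardo_kernel s (x - y)) \<partial>lborel) \<partial>lborel)"
  unfolding gagliardo_def nn_integral_completion
  by (simp add: ennreal_mult[symmetric])

section \<open>Coarea inequality and the lower bound for the Hardy constant\<close>

lemma nn_integral_layer_cake_difference:
  fixes a b :: real
  assumes "0 \<le> a" "0 \<le> b"
  shows "(\<integral>\<^sup>+ t. (if 0 \<le> t \<and> (t < a) \<noteq> (t < b) then k else 0) \<partial>lborel) = ennreal \<bar>a - b\<bar> * k"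
proof -
  have "(\<integral>\<^sup>+ t. (if 0 \<le> t \<and> (t < a) \<noteq> (t < b) then k else 0) \<partial>lborel)
      = (\<integral>\<^sup>+ t. k * indicator {min a b..<max a b} t \<partial>lborel)"
    using assms by (intro nn_integral_cong) (auto simp: indicator_def)
  also have "\<dots> = k * ennreal (max a b - min a b)"
    by (subst nn_integral_cmult_indicator) auto
  also have "max a b - min a b = \<bar>a - b\<bar>" by auto
  finally show ?thesis by (simp add: mult.commute)
qed

text \<open>Half of the coarea formula: equality holds for \<open>\<bar>u\<bar>\<close>, and passing from \<open>u\<close> to \<open>\<bar>u\<bar>\<close>
  does not increase the seminorm.\<close>

lemma gagliardo_ge_integral_level_perimeters:
  fixes u :: "'a::euclidean_space \<Rightarrow> real"
  assumes [measurable]: "u \<in> borel_measurable borel"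
  shows "(\<integral>\<^sup>+ t. frac_perimeter s {x. t < \<bar>u x\<bar>} * indicator {0..} t \<partial>lborel) \<le> gagliardo s u"
proof -
  define D :: "'a \<Rightarrow> 'a \<Rightarrow> real \<Rightarrow> ennreal" where
    "D = (\<lambda>x y t. if 0 \<le> t \<and> (t < \<bar>u x\<bar>) \<noteq> (t < \<bar>u y\<bar>) then ennreal (gagliardo_kernel s (x - y)) else 0)"
  have [measurable]: "(\<lambda>w. D (f w) (g w) (h w)) \<in> borel_measurable M"
    if [measurable]: "f \<in> borel_measurable M" "g \<in> borel_measurable M" "h \<in> borel_measurable M" for M :: "'b measure" and f g h
    unfolding D_def by measurable
  have "(\<integral>\<^sup>+ t. frac_perimeter s {x. t < \<bar>u x\<bar>} * indicator {0..} t \<partial>lborel)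
      = (\<integral>\<^sup>+ t. (\<integral>\<^sup>+ y. (\<integral>\<^sup>+ x. D x y t \<partial>lborel) \<partial>lborel) \<partial>lborel)"
  proof (intro nn_integral_cong)
    fix t :: real
    show "frac_perimeter s {x. t < \<bar>u x\<bar>} * indicator {0..} t = (\<integral>\<^sup>+ y. (\<integral>\<^sup>+ x. D x y t \<partial>lborel) \<partial>lborel)"
    proof (cases "0 \<le> t")
      case True
      then show ?thesis unfolding frac_perimeter_def gagliardo_lborel D_def
        by (auto simp: indicator_def intro!: nn_integral_cong)
    qed (simp add: D_def)
  qed
  also have "\<dots> = (\<integral>\<^sup>+ y. (\<integral>\<^sup>+ t. (\<integral>\<^sup>+ x. D x y t \<partial>lborel) \<partial>lborel) \<partial>lborel)"
    by (subst lborel_pair.Fubini') (simp_all add: split_beta')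
  also have "\<dots> = (\<integral>\<^sup>+ y. (\<integral>\<^sup>+ x. (\<integral>\<^sup>+ t. D x y t \<partial>lborel) \<partial>lborel) \<partial>lborel)"
    by (subst lborel_pair.Fubini') (simp_all add: split_beta')
  also have "\<dots> = (\<integral>\<^sup>+ y. (\<integral>\<^sup>+ x. ennreal \<bar>\<bar>u x\<bar> - \<bar>u y\<bar>\<bar> * ennreal (gagliardo_kernel s (x - y)) \<partial>lborel) \<partial>lborel)"
    unfolding D_def by (subst nn_integral_layer_cake_difference) auto
  also have "\<dots> \<le> gagliardo s u"
    unfolding gagliardo_lborel by (intro nn_integral_mono mult_right_mono ennreal_leI) auto
  finally show ?thesis .
qed

lemma bdist_borel [measurable]: "bdist \<Omega> \<in> borel_measurable borel"
  unfolding bdist_def[abs_def] by (intro borel_measurable_continuous_onI continuous_intros)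

text \<open>Cavalieri's principle for the measure with density \<open>1 / bdist \<Omega> x powr s\<close>.\<close>

lemma weighted_integral_eq_integral_level_volumes:
  fixes u :: "'a::euclidean_space \<Rightarrow> real"
  assumes [measurable]: "u \<in> borel_measurable borel" and supp: "{x. u x \<noteq> 0} \<subseteq> \<Omega>"
  shows "(\<integral>\<^sup>+ x\<in>\<Omega>. ennreal (\<bar>u x\<bar> / bdist \<Omega> x powr s) \<partial>lebesgue)
       = (\<integral>\<^sup>+ t. weighted_volume s \<Omega> {x. t < \<bar>u x\<bar>} * indicator {0..} t \<partial>lborel)"
proof -
  \<comment> \<open>The atom \<open>t < 0\<close> puts \<open>D\<close> into the form of the layer-cake integrand for the pair \<open>\<bar>u x\<bar>, 0\<close>.\<close>
  define D :: "'a \<Rightarrow> real \<Rightarrow> ennreal" where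
    "D = (\<lambda>x t. if 0 \<le> t \<and> (t < \<bar>u x\<bar>) \<noteq> (t < 0) then ennreal (1 / bdist \<Omega> x powr s) else 0)"
  have [measurable]: "(\<lambda>(x, t). D x t) \<in> borel_measurable (borel \<Otimes>\<^sub>M borel)"
    unfolding D_def split_beta' by measurable
  have "(\<integral>\<^sup>+ x\<in>\<Omega>. ennreal (\<bar>u x\<bar> / bdist \<Omega> x powr s) \<partial>lebesgue)
      = (\<integral>\<^sup>+ x. (\<integral>\<^sup>+ t. D x t \<partial>lborel) \<partial>lborel)"
    unfolding D_def nn_integral_completion
    using supp by (subst nn_integral_layer_cake_difference)
      (auto simp: indicator_def ennreal_mult[symmetric] intro!: nn_integral_cong)
  also have "\<dots> = (\<integral>\<^sup>+ t. (\<integral>\<^sup>+ x. D x t \<partial>lborel) \<partial>lborel)"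
    by (subst lborel_pair.Fubini') (simp_all)
  also have "\<dots> = (\<integral>\<^sup>+ t. weighted_volume s \<Omega> {x. t < \<bar>u x\<bar>} * indicator {0..} t \<partial>lborel)"
    unfolding weighted_volume_def nn_integral_completion
  proof (intro nn_integral_cong)
    fix t :: real
    show "(\<integral>\<^sup>+ x. D x t \<partial>lborel)
      = (\<integral>\<^sup>+ x\<in>{x. t < \<bar>u x\<bar>}. ennreal (1 / bdist \<Omega> x powr s) \<partial>lborel) * indicator {0..} t"
      by (cases "0 \<le> t") (auto simp: D_def indicator_def intro!: nn_integral_cong)
  qed
  finally show ?thesis .
qed

lemma test_function_continuous:
  assumes "u \<in> test_functions \<Omega>"
  shows "continuous_on UNIV u"
  using assms k_times_cont_diff.simps(1) unfolding test_functions_def smooth_def by blast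

text \<open>The infinite and zero denominators are covered by the conventions \<open>a / \<infinity> = 0\<close> and
  \<open>a * 0 = 0\<close> of extended arithmetic.\<close>

lemma cheeger_const_mult_volume_le_perimeter:
  assumes "compactly_inside E \<Omega>" "emeasure lebesgue E > 0"
  shows "cheeger_const s \<Omega> * weighted_volume s \<Omega> E \<le> frac_perimeter s E"
proof -
  let ?V = "weighted_volume s \<Omega> E" and ?P = "frac_perimeter s E"
  have le: "cheeger_const s \<Omega> \<le> ?P / ?V"
    unfolding cheeger_const_def using assms by (intro INF_lower) auto
  consider "?V = 0" | "?V = top" | "?V \<noteq> 0" "?V \<noteq> top" by auto
  then show ?thesis
  proof cases
    case 3
    then have "?P / ?V * ?V = ?P"
      by (simp add: ennreal_divide_times less_top[symmetric] zero_less_iff_neq_zero)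
    with mult_right_mono[OF le, of ?V] show ?thesis by simp
  qed (use le in auto)
qed

lemma cheeger_const_le_hardy_const: "cheeger_const s \<Omega> \<le> hardy_const s \<Omega>"
  unfolding hardy_const_def
proof (rule INF_greatest, clarify)
  fix u assume u: "u \<in> test_functions \<Omega>"
    and norm1: "(\<integral>\<^sup>+ x\<in>\<Omega>. ennreal (\<bar>u x\<bar> / bdist \<Omega> x powr s) \<partial>lebesgue) = 1"
  have cont: "continuous_on UNIV u" by (rule test_function_continuous[OF u])
  then have [measurable]: "u \<in> borel_measurable borel" by (rule borel_measurable_continuous_onI)
  have supp: "compact (closure {x. u x \<noteq> 0})" "closure {x. u x \<noteq> 0} \<subseteq> \<Omega>"
    using u by (auto simp: test_functions_def)
  have level: "cheeger_const s \<Omega> * weighted_volume s \<Omega> {x. t < \<bar>u x\<bar>} \<le> frac_perimeter s {x. t < \<bar>u x\<bar>}"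
    if "0 \<le> t" for t
  proof (cases "{x. t < \<bar>u x\<bar>} = {}")
    case True
    then show ?thesis by (simp add: weighted_volume_def)
  next
    case False
    have op: "open {x. t < \<bar>u x\<bar>}"
      by (intro open_Collect_less continuous_intros continuous_on_rabs cont)
    have sub: "{x. t < \<bar>u x\<bar>} \<subseteq> {x. u x \<noteq> 0}" using that by auto
    have "compactly_inside {x. t < \<bar>u x\<bar>} \<Omega>"
      unfolding compactly_inside_def
      using op closure_mono[OF sub] supp by (auto simp: compact_closure bounded_subset[OF _ sub])
    moreover have "emeasure lebesgue {x. t < \<bar>u x\<bar>} > 0"
      using emeasure_open_pos[OF op False] op by simp
    ultimately show ?thesis by (rule cheeger_const_mult_volume_le_perimeter)
  qed
  have [measurable]: "(\<lambda>t. weighted_volume s \<Omega> {x. t < \<bar>u x\<bar>}) \<in> borel_measurable borel"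
  proof -
    have "(\<lambda>t. weighted_volume s \<Omega> {x. t < \<bar>u x\<bar>})
        = (\<lambda>t. \<integral>\<^sup>+ x. (if t < \<bar>u x\<bar> then ennreal (1 / bdist \<Omega> x powr s) else 0) \<partial>lborel)"
      unfolding weighted_volume_def nn_integral_completion
      by (auto simp: indicator_def intro!: nn_integral_cong)
    also have "\<dots> \<in> borel_measurable borel" by measurable
    finally show ?thesis .
  qed
  have "cheeger_const s \<Omega> = cheeger_const s \<Omega> * (\<integral>\<^sup>+ t. weighted_volume s \<Omega> {x. t < \<bar>u x\<bar>} * indicator {0..} t \<partial>lborel)"
    using weighted_integral_eq_integral_level_volumes[of u \<Omega> s] norm1 supp closure_subset
    by (metis (no_types, lifting) \<open>u \<in> borel_measurable borel\<close> mult.right_neutral order_trans)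
  also have "\<dots> = (\<integral>\<^sup>+ t. cheeger_const s \<Omega> * (weighted_volume s \<Omega> {x. t < \<bar>u x\<bar>} * indicator {0..} t) \<partial>lborel)"
    by (rule nn_integral_cmult[symmetric]) measurable
  also have "\<dots> \<le> (\<integral>\<^sup>+ t. frac_perimeter s {x. t < \<bar>u x\<bar>} * indicator {0..} t \<partial>lborel)"
    using level by (intro nn_integral_mono) (auto simp: indicator_def)
  also have "\<dots> \<le> gagliardo s u" by (rule gagliardo_ge_integral_level_perimeters) measurable
  finally show "cheeger_const s \<Omega> \<le> gagliardo s u" .
qed

section \<open>Smooth functions\<close>

lemma smooth_differentiable: "smooth f \<Longrightarrow> f differentiable (at x)"
  unfolding smooth_def using k_times_cont_diff.simps(2) by blast

lemma smooth_derivative: "smooth f \<Longrightarrow> smooth (\<lambda>x. frechet_derivative f (at x) v)"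
  unfolding smooth_def using k_times_cont_diff.simps(2) by blast

lemma smooth_continuous: "smooth f \<Longrightarrow> continuous_on UNIV f"
  unfolding smooth_def using k_times_cont_diff.simps(1) by blast

text \<open>Smoothness is the greatest class of differentiable functions closed under directional
  derivatives. This is the way convolutions are shown to be smooth, as differentiating them
  only differentiates the convolution kernel.\<close>

lemma smooth_coinduct:
  assumes "f \<in> C"
    and "\<And>f x. f \<in> C \<Longrightarrow> f differentiable (at x)"
    and "\<And>f v. f \<in> C \<Longrightarrow> (\<lambda>x. frechet_derivative f (at x) v) \<in> C"
  shows "smooth f"
proof -
  have "\<forall>f\<in>C. k_times_cont_diff k f" for k
  proof (induction k)
    case 0
    show ?case
    proof
      fix f assume "f \<in> C"
      then have "\<And>x. isCont f x" by (intro differentiable_imp_continuous_within assms(2))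
      then show "k_times_cont_diff 0 f" by (simp add: continuous_on_eq_continuous_at)
    qed
  next
    case (Suc k)
    show ?case
    proof
      fix f assume f: "f \<in> C"
      show "k_times_cont_diff (Suc k) f"
        unfolding k_times_cont_diff.simps
        by (intro conjI allI assms(2) f Suc.IH[THEN bspec] assms(3))
    qed
  qed
  with assms(1) show ?thesis unfolding smooth_def by blast
qed

lemma frechet_derivative_eqI:
  assumes "\<And>x. (f has_derivative D x) (at x)"
  shows "(\<lambda>x. frechet_derivative f (at x) v) = (\<lambda>x. D x v)"
  by (simp add: frechet_derivative_at[OF assms, symmetric])

lemma k_times_cont_diff_lincomb:
  assumes "\<And>j. j \<in> J \<Longrightarrow> k_times_cont_diff k (f j)"
  shows "k_times_cont_diff k (\<lambda>x. \<Sum>j\<in>J. a j * f j x)"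
  using assms
proof (induction k arbitrary: f)
  case 0
  then show ?case by (auto intro!: continuous_intros)
next
  case (Suc k)
  have D: "((\<lambda>x. \<Sum>j\<in>J. a j * f j x) has_derivative
      (\<lambda>h. \<Sum>j\<in>J. a j * frechet_derivative (f j) (at x) h)) (at x)" for x
    using Suc.prems by (auto intro!: derivative_eq_intros simp: frechet_derivative_works[symmetric])
  then have "(\<lambda>x. frechet_derivative (\<lambda>x. \<Sum>j\<in>J. a j * f j x) (at x) v)
      = (\<lambda>x. \<Sum>j\<in>J. a j * frechet_derivative (f j) (at x) v)" for v
    by (rule frechet_derivative_eqI)
  moreover have "k_times_cont_diff k (\<lambda>x. \<Sum>j\<in>J. a j * frechet_derivative (f j) (at x) v)" for v
    using Suc.prems by (intro Suc.IH) auto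
  ultimately show ?case using D by (auto simp: differentiable_def)
qed

lemma smooth_cmult:
  assumes "smooth f"
  shows "smooth (\<lambda>x. c * f x)"
  using k_times_cont_diff_lincomb[of "{()}" _ "\<lambda>_. f" "\<lambda>_. c"] assms by (simp add: smooth_def)

section \<open>A smooth bump function\<close>

text \<open>The functions \<open>p(1/t) exp(-1/t)\<close>, extended by 0 to \<open>t \<le> 0\<close>. Letting \<open>p\<close> range over all
  polynomials makes the family closed under differentiation.\<close>

definition flat_exp :: "real poly \<Rightarrow> real \<Rightarrow> real" where
  "flat_exp p t = (if t \<le> 0 then 0 else poly p (1 / t) * exp (- (1 / t)))"

lemma poly_times_exp_minus_tendsto_0: "((\<lambda>x::real. poly p x * exp (- x)) \<longlongrightarrow> 0) at_top"
proof -
  have "((\<lambda>x::real. \<Sum>i\<le>degree p. coeff p i * (x ^ i / exp x)) \<longlongrightarrow> (\<Sum>i\<le>degree p. coeff p i * 0)) at_top"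
    by (intro tendsto_intros tendsto_power_div_exp_0)
  then show ?thesis
    by (simp add: poly_altdef sum_distrib_right exp_minus divide_inverse mult.assoc)
qed

lemma flat_exp_has_derivative:
  "(flat_exp p has_real_derivative flat_exp (monom 1 2 * (p - pderiv p)) t) (at t)"
proof -
  consider "t < 0" | "t > 0" | "t = 0" by linarith
  then show ?thesis
  proof cases
    case 1
    have "((\<lambda>_. 0) has_real_derivative flat_exp (monom 1 2 * (p - pderiv p)) t) (at t)"
      using 1 by (simp add: flat_exp_def)
    then show ?thesis
      by (rule DERIV_cong_ev[THEN iffD1, rotated 3, OF _ refl _ refl])
         (use 1 in \<open>auto simp: flat_exp_def eventually_at intro!: exI[of _ "-t"] simp: eventually_nhds_metric dist_real_def\<close>)
  next
    case 2
    have "((\<lambda>t. poly p (1 / t) * exp (- (1 / t))) has_real_derivative flat_exp (monom 1 2 * (p - pderiv p)) t) (at t)"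
      using 2 by (auto intro!: derivative_eq_intros DERIV_chain2[OF poly_DERIV]
          simp: flat_exp_def poly_monom power2_eq_square field_simps)
    then show ?thesis
      by (rule DERIV_cong_ev[THEN iffD1, rotated 3, OF _ refl _ refl])
         (use 2 in \<open>auto simp: flat_exp_def eventually_nhds_metric dist_real_def intro!: exI[of _ t]\<close>)
  next
    case 3
    \<comment> \<open>At the origin the difference quotient is again of the form \<open>q(1/t) exp(-1/t)\<close>, which vanishes in the limit.\<close>
    have "((\<lambda>x. flat_exp p x / x) \<longlongrightarrow> 0) (at_left 0)"
      by (rule tendsto_eventually) (auto simp: eventually_at_left_field flat_exp_def intro!: exI[of _ "-1"])
    moreover have "((\<lambda>x. flat_exp p x / x) \<longlongrightarrow> 0) (at_right 0)"
    proof -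
      have "((\<lambda>x::real. poly (monom 1 1 * p) (inverse x) * exp (- inverse x)) \<longlongrightarrow> 0) (at_right 0)"
        by (rule filterlim_compose[OF poly_times_exp_minus_tendsto_0 filterlim_inverse_at_top_right])
      then show ?thesis
        by (rule Lim_transform_eventually)
           (auto simp: eventually_at_right_field flat_exp_def poly_monom field_simps intro!: exI[of _ 1])
    qed
    ultimately have "((\<lambda>x. flat_exp p x / x) \<longlongrightarrow> 0) (at 0)"
      by (rule filterlim_split_at)
    then show ?thesis using 3 by (simp add: has_field_derivative_iff flat_exp_def)
  qed
qed

text \<open>The polynomials that occur in the iterated derivatives of \<open>exp(-1/t)\<close>.\<close>

primrec flat_poly :: "nat \<Rightarrow> real poly" where
  "flat_poly 0 = 1"
| "flat_poly (Suc k) = monom 1 2 * (flat_poly k - pderiv (flat_poly k))"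

text \<open>The product rule writes a directional derivative as a linear combination of products of the
  same shape, with the order of one factor raised. Hence the induction runs over arbitrary
  orders \<open>k\<close>.\<close>

lemma k_times_cont_diff_prod_flat_exp:
  fixes I :: "'a::euclidean_space set"
  assumes "finite I"
  shows "k_times_cont_diff m (\<lambda>x. \<Prod>c\<in>I. flat_exp (flat_poly (k c)) (1 + x \<bullet> c))"
proof (induction m arbitrary: k)
  case (Suc m k)
  let ?g = "\<lambda>k x. \<Prod>c\<in>I. flat_exp (flat_poly (k c)) (1 + x \<bullet> c)"
  have D1: "((\<lambda>x. flat_exp (flat_poly (k c)) (1 + x \<bullet> c)) has_derivative
        (\<lambda>h. flat_exp (flat_poly (Suc (k c))) (1 + x \<bullet> c) * (h \<bullet> c))) (at x)" for c x
  proof -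
    have "((\<lambda>x. 1 + x \<bullet> c) has_derivative (\<lambda>h. h \<bullet> c)) (at x)"
      by (auto intro!: derivative_eq_intros)
    from has_derivative_compose[OF this, of "flat_exp (flat_poly (k c))"
        "\<lambda>h. flat_exp (flat_poly (Suc (k c))) (1 + x \<bullet> c) * h"]
    show ?thesis
      using flat_exp_has_derivative[of "flat_poly (k c)" "1 + x \<bullet> c"]
      by (simp add: has_field_derivative_def)
  qed
  have D: "(?g k has_derivative (\<lambda>h. \<Sum>c\<in>I. (h \<bullet> c) * ?g (k(c := Suc (k c))) x)) (at x)" for x
  proof -
    have eq: "flat_exp (flat_poly (Suc (k c))) (1 + x \<bullet> c) * (h \<bullet> c) *
            (\<Prod>j\<in>I - {c}. flat_exp (flat_poly (k j)) (1 + x \<bullet> j))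
        = (h \<bullet> c) * ?g (k(c := Suc (k c))) x" if "c \<in> I" for c h
      using that assms by (subst prod.remove[of I c]) (auto intro!: prod.cong)
    have "(?g k has_derivative (\<lambda>h. \<Sum>c\<in>I. flat_exp (flat_poly (Suc (k c))) (1 + x \<bullet> c) * (h \<bullet> c) *
            (\<Prod>j\<in>I - {c}. flat_exp (flat_poly (k j)) (1 + x \<bullet> j)))) (at x)"
      by (rule has_derivative_prod) (rule D1)
    also have "(\<lambda>h. \<Sum>c\<in>I. flat_exp (flat_poly (Suc (k c))) (1 + x \<bullet> c) * (h \<bullet> c) *
            (\<Prod>j\<in>I - {c}. flat_exp (flat_poly (k j)) (1 + x \<bullet> j)))
        = (\<lambda>h. \<Sum>c\<in>I. (h \<bullet> c) * ?g (k(c := Suc (k c))) x)"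
      by (intro ext sum.cong refl eq)
    finally show ?thesis .
  qed
  then have "(\<lambda>x. frechet_derivative (?g k) (at x) v)
      = (\<lambda>x. \<Sum>c\<in>I. (v \<bullet> c) * ?g (k(c := Suc (k c))) x)" for v
    by (rule frechet_derivative_eqI)
  moreover have "k_times_cont_diff m (\<lambda>x. \<Sum>c\<in>I. (v \<bullet> c) * ?g (k(c := Suc (k c))) x)" for v
    by (intro k_times_cont_diff_lincomb Suc.IH)
  ultimately show ?case using D by (auto simp: differentiable_def)
next
  case 0
  have "continuous_on UNIV (flat_exp p)" for p
    by (intro continuous_at_imp_continuous_on ballI DERIV_isCont[OF flat_exp_has_derivative])
  then have "continuous_on UNIV (\<lambda>x. flat_exp p (1 + x \<bullet> c))" for p and c :: 'a
    by (rule continuous_on_compose2) (auto intro!: continuous_intros)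
  then show ?case by (auto intro!: continuous_on_prod)
qed

text \<open>The product of the factors for \<open>t b\<close> and \<open>-t b\<close> vanishes outside the slab \<open>\<bar>x \<bullet> b\<bar> < 1 / t\<close>, so the
  product over all basis vectors \<open>b\<close> is supported in a cube. With \<open>t = DIM('a) / e\<close> the
  \<open>l\<^sup>1\<close>-norm on this cube is at most \<open>e\<close>.\<close>

lemma smooth_bump_exists:
  assumes "0 < e"
  obtains \<rho> :: "'a::euclidean_space \<Rightarrow> real"
  where "smooth \<rho>" "\<And>x. 0 \<le> \<rho> x" "0 < \<rho> 0" "\<And>x. \<rho> x \<noteq> 0 \<Longrightarrow> norm x \<le> e"
proof
  define t where "t = DIM('a) / e"
  define I :: "'a set" where "I = (\<lambda>b. t *\<^sub>R b) ` Basis \<union> (\<lambda>b. - t *\<^sub>R b) ` Basis"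
  let ?r = "\<lambda>x::'a. \<Prod>c\<in>I. flat_exp (flat_poly 0) (1 + x \<bullet> c)"
  have t: "t > 0" using assms by (simp add: t_def)
  have fin: "finite I" by (simp add: I_def)
  show "smooth ?r"
    unfolding smooth_def using k_times_cont_diff_prod_flat_exp[OF fin, of _ "\<lambda>_. 0"] by blast
  show "0 \<le> ?r x" for x by (intro prod_nonneg) (simp add: flat_exp_def)
  show "0 < ?r 0" by (intro prod_pos) (simp add: flat_exp_def)
  show "norm x \<le> e" if "?r x \<noteq> 0" for x
  proof -
    have pos: "1 + x \<bullet> c > 0" if "c \<in> I" for c
      using \<open>?r x \<noteq> 0\<close> that fin by (auto simp: flat_exp_def not_le[symmetric])
    have "\<bar>x \<bullet> b\<bar> \<le> 1 / t" if b: "b \<in> Basis" for b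
      using pos[of "t *\<^sub>R b"] pos[of "- t *\<^sub>R b"] b t by (auto simp: I_def field_simps abs_le_iff)
    then have "norm x \<le> (\<Sum>b\<in>(Basis::'a set). 1 / t)"
      by (intro order_trans[OF norm_le_l1] sum_mono)
    then show ?thesis using assms by (simp add: t_def)
  qed
qed

section \<open>Uniform estimates for smooth functions of bounded support\<close>

lemma smooth_bounded:
  fixes g :: "'a::euclidean_space \<Rightarrow> real"
  assumes "smooth g" "bounded {x. g x \<noteq> 0}"
  obtains M where "0 \<le> M" "\<And>x. \<bar>g x\<bar> \<le> M"
proof -
  have "compact (g ` closure {x. g x \<noteq> 0})"
    using assms by (intro compact_continuous_image continuous_on_subset[OF smooth_continuous]) (auto simp: compact_closure)
  then have "\<exists>M. \<forall>x\<in>closure {x. g x \<noteq> 0}. \<bar>g x\<bar> \<le> M"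
    by (auto dest!: compact_imp_bounded simp: bounded_iff)
  then obtain M where M: "\<And>x. x \<in> closure {x. g x \<noteq> 0} \<Longrightarrow> \<bar>g x\<bar> \<le> M"
    by blast
  have "\<bar>g x\<bar> \<le> max 0 M" for x
    using M[of x] closure_subset[of "{x. g x \<noteq> 0}"] by (cases "g x = 0") auto
  then show ?thesis by (intro that[of "max 0 M"]) auto
qed

lemma frechet_derivative_support_subset:
  fixes g :: "'a::euclidean_space \<Rightarrow> real"
  shows "{x. frechet_derivative g (at x) v \<noteq> 0} \<subseteq> closure {x. g x \<noteq> 0}"
proof (rule subsetI, rule ccontr)
  fix x assume x: "x \<in> {x. frechet_derivative g (at x) v \<noteq> 0}" "x \<notin> closure {x. g x \<noteq> 0}"
  have "(g has_derivative (\<lambda>_. 0)) (at x)"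
    by (rule has_derivative_transform_within_open[OF has_derivative_const[of 0], where s = "- closure {x. g x \<noteq> 0}"])
      (use x(2) closure_subset[of "{x. g x \<noteq> 0}"] in auto)
  then have "frechet_derivative g (at x) = (\<lambda>_. 0)" by (rule frechet_derivative_at[symmetric])
  with x(1) show False by simp
qed

lemma bounded_derivative_support:
  fixes g :: "'a::euclidean_space \<Rightarrow> real"
  assumes "bounded {x. g x \<noteq> 0}"
  shows "bounded {x. frechet_derivative g (at x) v \<noteq> 0}"
  using bounded_subset[OF bounded_closure[OF assms] frechet_derivative_support_subset] .

lemma frechet_derivative_basis_sum:
  fixes g :: "'a::euclidean_space \<Rightarrow> real"
  assumes "smooth g"
  shows "frechet_derivative g (at x) h = (\<Sum>b\<in>Basis. (h \<bullet> b) * frechet_derivative g (at x) b)"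
proof -
  have "linear (frechet_derivative g (at x))"
    by (intro linear_frechet_derivative smooth_differentiable assms)
  then have "frechet_derivative g (at x) (\<Sum>b\<in>Basis. (h \<bullet> b) *\<^sub>R b) = (\<Sum>b\<in>Basis. (h \<bullet> b) * frechet_derivative g (at x) b)"
    by (simp add: linear_sum linear_cmul)
  then show ?thesis by (simp add: euclidean_representation)
qed

lemma smooth_mean_value:
  fixes g :: "'a::euclidean_space \<Rightarrow> real"
  assumes "smooth g"
  obtains \<theta> where "0 \<le> \<theta>" "\<theta> \<le> 1" "g (x + h) - g x = frechet_derivative g (at (x + \<theta> *\<^sub>R h)) h"
proof -
  have "((\<lambda>t. g (x + t *\<^sub>R h)) has_derivative
      (\<lambda>k. frechet_derivative g (at (x + t *\<^sub>R h)) (k *\<^sub>R h))) (at t within {0..1})" for t :: real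
    using smooth_differentiable[OF assms]
    by (intro has_derivative_compose[of "\<lambda>t. x + t *\<^sub>R h" _ t _ g])
      (auto intro!: derivative_eq_intros simp: frechet_derivative_works[symmetric])
  from mvt_very_simple[OF zero_le_one this]
  obtain \<theta> where "\<theta> \<in> {0..1}" "g (x + 1 *\<^sub>R h) - g (x + 0 *\<^sub>R h)
       = frechet_derivative g (at (x + \<theta> *\<^sub>R h)) ((1 - 0) *\<^sub>R h)"
    by blast
  then show ?thesis by (intro that[of \<theta>]) auto
qed

lemma smooth_lipschitz:
  fixes g :: "'a::euclidean_space \<Rightarrow> real"
  assumes g: "smooth g" "bounded {x. g x \<noteq> 0}"
  obtains L where "0 \<le> L" "\<And>x h. \<bar>g (x + h) - g x\<bar> \<le> L * norm h"
proof -
  have "\<forall>b. \<exists>M\<ge>0. \<forall>x. \<bar>frechet_derivative g (at x) b\<bar> \<le> M"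
    using smooth_bounded[OF smooth_derivative[OF g(1)] bounded_derivative_support[OF g(2)]] by metis
  then obtain M where M: "\<And>b. 0 \<le> M b" "\<And>b x. \<bar>frechet_derivative g (at x) b\<bar> \<le> M b" by metis
  have "\<bar>g (x + h) - g x\<bar> \<le> (\<Sum>b\<in>Basis. M b) * norm h" for x h
  proof -
    obtain \<theta> where "g (x + h) - g x = frechet_derivative g (at (x + \<theta> *\<^sub>R h)) h"
      using smooth_mean_value[OF g(1)] by metis
    also have "\<dots> = (\<Sum>b\<in>Basis. (h \<bullet> b) * frechet_derivative g (at (x + \<theta> *\<^sub>R h)) b)"
      by (rule frechet_derivative_basis_sum[OF g(1)])
    finally have "\<bar>g (x + h) - g x\<bar> \<le> (\<Sum>b\<in>Basis. \<bar>h \<bullet> b\<bar> * \<bar>frechet_derivative g (at (x + \<theta> *\<^sub>R h)) b\<bar>)"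
      by (simp add: sum_abs abs_mult[symmetric])
    also have "\<dots> \<le> (\<Sum>b\<in>Basis. norm h * M b)"
      by (intro sum_mono mult_mono M Basis_le_norm) auto
    finally show ?thesis by (simp add: sum_distrib_left mult.commute)
  qed
  then show ?thesis by (intro that[of "\<Sum>b\<in>Basis. M b"]) (auto intro: sum_nonneg M)
qed

text \<open>The remainder is quadratic because the partial derivatives are again smooth with bounded
  support, hence Lipschitz. The bound is uniform in \<open>x\<close>, which makes differentiation under the
  integral sign possible.\<close>

lemma smooth_taylor:
  fixes g :: "'a::euclidean_space \<Rightarrow> real"
  assumes g: "smooth g" "bounded {x. g x \<noteq> 0}"
  obtains C where "0 \<le> C" "\<And>x h. \<bar>g (x + h) - g x - frechet_derivative g (at x) h\<bar> \<le> C * (norm h * norm h)"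
proof -
  let ?D = "\<lambda>b x. frechet_derivative g (at x) b"
  have "\<forall>b. \<exists>L\<ge>0. \<forall>x h. \<bar>?D b (x + h) - ?D b x\<bar> \<le> L * norm h"
    using smooth_lipschitz[OF smooth_derivative[OF g(1)] bounded_derivative_support[OF g(2)]] by metis
  then obtain L where L: "\<And>b. 0 \<le> L b" "\<And>b x h. \<bar>?D b (x + h) - ?D b x\<bar> \<le> L b * norm h" by metis
  have "\<bar>g (x + h) - g x - ?D h x\<bar> \<le> (\<Sum>b\<in>Basis. L b) * (norm h * norm h)" for x h
  proof -
    obtain \<theta> where \<theta>: "0 \<le> \<theta>" "\<theta> \<le> 1" "g (x + h) - g x = ?D h (x + \<theta> *\<^sub>R h)"
      using smooth_mean_value[OF g(1)] by metis
    have "g (x + h) - g x - ?D h x = (\<Sum>b\<in>Basis. (h \<bullet> b) * (?D b (x + \<theta> *\<^sub>R h) - ?D b x))"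
      unfolding \<theta>(3) frechet_derivative_basis_sum[OF g(1), of _ h]
      by (simp add: right_diff_distrib sum_subtractf)
    then have "\<bar>g (x + h) - g x - ?D h x\<bar> \<le> (\<Sum>b\<in>Basis. \<bar>h \<bullet> b\<bar> * \<bar>?D b (x + \<theta> *\<^sub>R h) - ?D b x\<bar>)"
      by (simp add: sum_abs abs_mult[symmetric])
    also have "\<dots> \<le> (\<Sum>b\<in>Basis. norm h * (L b * norm h))"
    proof (intro sum_mono mult_mono Basis_le_norm)
      fix b
      have "\<bar>?D b (x + \<theta> *\<^sub>R h) - ?D b x\<bar> \<le> L b * norm (\<theta> *\<^sub>R h)" by (rule L)
      also have "\<dots> \<le> L b * norm h"
        using \<theta> by (intro mult_left_mono L) (simp add: mult_left_le_one_le)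
      finally show "\<bar>?D b (x + \<theta> *\<^sub>R h) - ?D b x\<bar> \<le> L b * norm h" .
    qed auto
    finally show ?thesis by (simp add: sum_distrib_left sum_distrib_right ac_simps)
  qed
  then show ?thesis by (intro that[of "\<Sum>b\<in>Basis. L b"]) (auto intro: sum_nonneg L)
qed

section \<open>Smoothing of indicator functions by convolution\<close>

text \<open>The convolution of \<open>g\<close> with the indicator function of \<open>E\<close>.\<close>

definition mollify :: "'a::euclidean_space set \<Rightarrow> ('a \<Rightarrow> real) \<Rightarrow> 'a \<Rightarrow> real" where
  "mollify E g x = (LINT y:E|lborel. g (x - y))"

lemma mollify_integrable:
  fixes g :: "'a::euclidean_space \<Rightarrow> real"
  assumes "smooth g" "bounded {x. g x \<noteq> 0}"
    and E: "E \<in> sets borel" "emeasure lborel E < \<infinity>"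
  shows "set_integrable lborel E (\<lambda>y. g (x - y))"
proof -
  obtain M where "\<And>x. \<bar>g x\<bar> \<le> M" using smooth_bounded[OF assms(1,2)] by metis
  moreover have [measurable]: "g \<in> borel_measurable borel"
    by (intro borel_measurable_continuous_onI smooth_continuous assms)
  ultimately show ?thesis
    unfolding set_integrable_def using E
    by (intro integrableI_bounded_set_indicator[where B = M]) auto
qed

lemma mollify_has_derivative:
  fixes g :: "'a::euclidean_space \<Rightarrow> real"
  assumes g: "smooth g" "bounded {x. g x \<noteq> 0}"
    and E: "E \<in> sets borel" "emeasure lborel E < \<infinity>"
  shows "(mollify E g has_derivative (\<lambda>h. mollify E (\<lambda>z. frechet_derivative g (at z) h) x)) (at x)"
proof -
  let ?D = "\<lambda>h x. mollify E (\<lambda>z. frechet_derivative g (at z) h) x"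
  note int = mollify_integrable[OF g E]
  note intD = mollify_integrable[OF smooth_derivative[OF g(1)] bounded_derivative_support[OF g(2)] E]
  obtain C where C: "0 \<le> C" "\<And>x h. \<bar>g (x + h) - g x - frechet_derivative g (at x) h\<bar> \<le> C * (norm h * norm h)"
    using smooth_taylor[OF g] by metis
  let ?K = "C * measure lborel E"
  show ?thesis
  proof (rule has_derivativeI_sandwich[where e = 1 and H = "\<lambda>y. ?K * norm (y - x)"])
    have lin: "linear (frechet_derivative g (at z))" for z
      by (intro linear_frechet_derivative smooth_differentiable g)
    have "linear (\<lambda>h. ?D h x)"
      using intD by (intro linearI) (simp_all add: mollify_def linear_add[OF lin] linear_cmul[OF lin])
    then show "bounded_linear (\<lambda>h. ?D h x)" by (simp add: linear_conv_bounded_linear)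
    show "((\<lambda>y. ?K * norm (y - x)) \<longlongrightarrow> 0) (at x)"
      by (auto intro!: tendsto_eq_intros)
    fix y assume "y \<noteq> x"
    let ?R = "\<lambda>t. g (y - t) - g (x - t) - frechet_derivative g (at (x - t)) (y - x)"
    have R: "\<bar>?R t\<bar> \<le> C * (norm (y - x) * norm (y - x))" for t
      using C(2)[of "x - t" "y - x"] by simp
    have iR: "set_integrable lborel E ?R"
      using int intD by (intro set_integral_diff)
    have "mollify E g y - mollify E g x - ?D (y - x) x = (LINT t:E|lborel. ?R t)"
      unfolding mollify_def using int intD by (simp add: set_integral_diff)
    also have "norm \<dots> \<le> (LINT t:E|lborel. \<bar>?R t\<bar>)"
      using set_integral_norm_bound[OF iR] by simp
    also have "\<dots> \<le> (LINT t:E|lborel. C * (norm (y - x) * norm (y - x)))"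
    proof (rule set_integral_mono[OF set_integrable_abs[OF iR] _ R])
      show "set_integrable lborel E (\<lambda>t. C * (norm (y - x) * norm (y - x)))"
        using E by (simp add: set_integrable_def)
    qed
    also have "\<dots> = ?K * norm (y - x) * norm (y - x)"
      using E by (simp add: set_lebesgue_integral_def)
    finally show "norm (mollify E g y - mollify E g x - ?D (y - x) x) / norm (y - x) \<le> ?K * norm (y - x)"
      using \<open>y \<noteq> x\<close> by (simp add: field_simps)
  qed auto
qed

lemma smooth_mollify:
  fixes g :: "'a::euclidean_space \<Rightarrow> real"
  assumes g: "smooth g" "bounded {x. g x \<noteq> 0}"
    and E: "E \<in> sets borel" "emeasure lborel E < \<infinity>"
  shows "smooth (mollify E g)"
proof (rule smooth_coinduct[where C = "{mollify E g | g. smooth g \<and> bounded {x. g x \<noteq> 0}}"])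
  fix f :: "'a \<Rightarrow> real" and x assume "f \<in> {mollify E g | g. smooth g \<and> bounded {x. g x \<noteq> 0}}"
  then show "f differentiable (at x)"
    using mollify_has_derivative[OF _ _ E] by (auto simp: differentiable_def)
next
  fix f :: "'a \<Rightarrow> real" and v assume "f \<in> {mollify E g | g. smooth g \<and> bounded {x. g x \<noteq> 0}}"
  then obtain g where g: "smooth g" "bounded {x. g x \<noteq> 0}" "f = mollify E g" by blast
  have "(\<lambda>x. frechet_derivative f (at x) v) = mollify E (\<lambda>z. frechet_derivative g (at z) v)"
    unfolding g(3) by (rule frechet_derivative_eqI) (rule mollify_has_derivative[OF g(1,2) E])
  with smooth_derivative[OF g(1)] bounded_derivative_support[OF g(2)]
  show "(\<lambda>x. frechet_derivative f (at x) v) \<in> {mollify E g | g. smooth g \<and> bounded {x. g x \<noteq> 0}}"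
    by blast
qed (use g in auto)

section \<open>Finite seminorm of smooth functions\<close>

text \<open>The exponent \<open>- s\<close> near the origin needs \<open>s < 1\<close>, the exponent \<open>- 1 - s\<close> at infinity
  needs \<open>s > 0\<close>.\<close>

lemma nn_integral_min_kernel_radial_finite:
  fixes s :: real
  assumes s: "0 < s" "s < 1"
  shows "(\<integral>\<^sup>+ R. ennreal (min 1 R * R powr (- 1 - s)) * indicator {0<..} R \<partial>lborel) < \<infinity>"
proof -
  have "(\<integral>\<^sup>+ R. ennreal (min 1 R * R powr (- 1 - s)) * indicator {0<..} R \<partial>lborel)
      \<le> (\<integral>\<^sup>+ R. ennreal (R powr (- s)) * indicator {0..1} R + ennreal (R powr (- 1 - s)) * indicator {1..} R \<partial>lborel)"
  proof (intro nn_integral_mono)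
    fix R :: real
    show "ennreal (min 1 R * R powr (- 1 - s)) * indicator {0<..} R
        \<le> ennreal (R powr (- s)) * indicator {0..1} R + ennreal (R powr (- 1 - s)) * indicator {1..} R"
    proof -
      consider "R \<le> 0" | "0 < R" "R \<le> 1" | "1 < R" by linarith
      then show ?thesis
      proof cases
        case 2
        then have "R * R powr (- 1 - s) = R powr (- s)"
          using powr_mult_base[of R "-1 - s"] by simp
        with 2 show ?thesis by (simp add: add_increasing2 min_def)
      qed (auto simp: indicator_def)
    qed
  qed
  also have "\<dots> = ennreal (1 powr (- s + 1) / (- s + 1)) + ennreal (- (1 powr (- 1 - s + 1)) / (- 1 - s + 1))"
    using nn_integral_has_integral_lebesgue'[OF _ has_integral_powr_from_0[of "- s" 1]]
      nn_integral_has_integral_lebesgue'[OF _ has_integral_powr_to_inf[of "- 1 - s" 1]] s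
    by (subst nn_integral_add) simp_all
  finally show ?thesis by (auto simp: less_top[symmetric] top_unique)
qed

text \<open>A substitute for polar coordinates: the kernel is dominated by a superposition of indicators
  of the balls \<open>{z. norm z < R}\<close>, whose volumes are known. On \<open>norm z < R \<le> 2 * norm z\<close> the
  integrand is at least \<open>min 1 (norm z) * (2 * norm z) powr (- N - s - 1)\<close>, and this interval
  has length \<open>norm z\<close>.\<close>

lemma min_kernel_le_radial_integral:
  fixes z :: "'a::euclidean_space"
  assumes "0 < s"
  shows "ennreal (min 1 (norm z) * gagliardo_kernel s z) \<le> ennreal (2 powr (real DIM('a) + s + 1)) *
     (\<integral>\<^sup>+ R. ennreal (min 1 R * R powr (- real DIM('a) - s - 1)) * indicator {norm z<..} R \<partial>lborel)"
proof (cases "z = 0")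
  case False
  define r where "r = norm z"
  have r: "0 < r" using False by (simp add: r_def)
  define p where "p = real DIM('a) + s + 1"
  have p: "p > 0" using assms by (simp add: p_def)
  have "(2 * r) powr (- p) * r * 2 powr p = r powr (- p) * r"
    using r by (simp add: powr_mult powr_minus field_simps)
  also have "r powr (- p) * r = r powr (- p + 1)"
    using r powr_mult_base[of r "- p"] by (simp add: mult.commute)
  also have "\<dots> = gagliardo_kernel s z" unfolding r_def[symmetric] p_def by (simp add: powr_minus_divide[symmetric])
  finally have g: "(2 * r) powr (- p) * r * 2 powr p = gagliardo_kernel s z" .
  have eq: "min 1 r * gagliardo_kernel s z = 2 powr p * (min 1 r * (2 * r) powr (- p) * r)"
    unfolding g[symmetric] by (simp only: ac_simps)
  have "ennreal (min 1 r * (2 * r) powr (- p)) * ennreal r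
      = (\<integral>\<^sup>+ R. ennreal (min 1 r * (2 * r) powr (- p)) * indicator {r<..2 * r} R \<partial>lborel)"
    using r by (subst nn_integral_cmult_indicator) auto
  also have "\<dots> \<le> (\<integral>\<^sup>+ R. ennreal (min 1 R * R powr (- p)) * indicator {r<..} R \<partial>lborel)"
    using r p by (intro nn_integral_mono)
       (auto simp: indicator_def intro!: ennreal_leI mult_mono powr_mono2')
  finally have "ennreal (min 1 r * (2 * r) powr (- p) * r)
     \<le> (\<integral>\<^sup>+ R. ennreal (min 1 R * R powr (- p)) * indicator {r<..} R \<partial>lborel)"
    using r by (simp add: ennreal_mult)
  then have "ennreal (2 powr p) * ennreal (min 1 r * (2 * r) powr (- p) * r)
     \<le> ennreal (2 powr p) * (\<integral>\<^sup>+ R. ennreal (min 1 R * R powr (- p)) * indicator {r<..} R \<partial>lborel)"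
    by (rule mult_left_mono) simp
  also have "ennreal (2 powr p) * ennreal (min 1 r * (2 * r) powr (- p) * r) = ennreal (min 1 r * gagliardo_kernel s z)"
    unfolding eq using r by (intro ennreal_mult[symmetric]) auto
  also have "- p = - real DIM('a) - s - 1" by (simp add: p_def)
  finally show ?thesis by (simp only: r_def p_def)
qed simp

lemma nn_integral_min_kernel_finite:
  fixes s :: real
  assumes s: "0 < s" "s < 1"
  shows "(\<integral>\<^sup>+ z. ennreal (min 1 (norm z) * gagliardo_kernel s z) \<partial>(lborel :: 'a::euclidean_space measure)) < \<infinity>"
proof -
  let ?N = "DIM('a)"
  let ?c = "ennreal (2 powr (real ?N + s + 1))"
  let ?h = "\<lambda>R. ennreal (min 1 R * R powr (- real ?N - s - 1))"
  have "(\<integral>\<^sup>+ z. ennreal (min 1 (norm z) * gagliardo_kernel s z) \<partial>(lborel :: 'a measure))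
      \<le> (\<integral>\<^sup>+ z. ?c * (\<integral>\<^sup>+ R. ?h R * indicator {norm (z::'a)<..} R \<partial>lborel) \<partial>lborel)"
    by (intro nn_integral_mono min_kernel_le_radial_integral s)
  also have "\<dots> = ?c * (\<integral>\<^sup>+ z. (\<integral>\<^sup>+ R. ?h R * (if norm (z::'a) < R then 1 else 0) \<partial>lborel) \<partial>lborel)"
    by (subst nn_integral_cmult[symmetric])
      (auto simp: indicator_def intro!: nn_integral_cong arg_cong2[of _ _ _ _ "(*)"])
  also have "(\<integral>\<^sup>+ z. (\<integral>\<^sup>+ R. ?h R * (if norm (z::'a) < R then 1 else 0) \<partial>lborel) \<partial>lborel)
      = (\<integral>\<^sup>+ R. (\<integral>\<^sup>+ z. ?h R * (if norm (z::'a) < R then 1 else 0) \<partial>lborel) \<partial>lborel)"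
    by (subst lborel_pair.Fubini') (simp_all add: split_beta')
  also have "\<dots> = (\<integral>\<^sup>+ R. ennreal (unit_ball_vol ?N) * (ennreal (min 1 R * R powr (- 1 - s)) * indicator {0<..} R) \<partial>lborel)"
  proof (intro nn_integral_cong)
    fix R :: real
    have "(\<integral>\<^sup>+ z. ?h R * (if norm (z::'a) < R then 1 else 0) \<partial>lborel)
       = (\<integral>\<^sup>+ z. ?h R * indicator (ball (0::'a) R) z \<partial>lborel)"
      by (intro nn_integral_cong) (auto simp: indicator_def)
    also have "\<dots> = ?h R * emeasure lborel (ball (0::'a) R)"
      by (subst nn_integral_cmult_indicator) auto
    also have "\<dots> = ennreal (unit_ball_vol ?N) * (ennreal (min 1 R * R powr (- 1 - s)) * indicator {0<..} R)"
    proof (cases "0 < R")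
      case True
      have "R powr (- real ?N - s - 1) * R ^ ?N = R powr (- 1 - s)"
      proof -
        have "R powr (- real ?N - s - 1) * R powr (real ?N) = R powr (- real ?N - s - 1 + real ?N)"
          by (simp only: powr_add)
        also have "- real ?N - s - 1 + real ?N = - 1 - s" by simp
        finally show ?thesis using True by (simp add: powr_realpow)
      qed
      then have "min 1 R * R powr (- real ?N - s - 1) * (unit_ball_vol ?N * R ^ ?N)
          = unit_ball_vol ?N * (min 1 R * R powr (- 1 - s))"
        by (metis (no_types, opaque_lifting) mult.assoc mult.commute)
      then show ?thesis
        using True by (simp add: emeasure_ball ennreal_mult[symmetric])
    next
      case False
      then show ?thesis by (simp add: ball_empty)
    qed
    finally show "(\<integral>\<^sup>+ z. ?h R * (if norm (z::'a) < R then 1 else 0) \<partial>lborel)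
       = ennreal (unit_ball_vol ?N) * (ennreal (min 1 R * R powr (- 1 - s)) * indicator {0<..} R)" .
  qed
  also have "\<dots> = ennreal (unit_ball_vol ?N) * (\<integral>\<^sup>+ R. ennreal (min 1 R * R powr (- 1 - s)) * indicator {0<..} R \<partial>lborel)"
    by (rule nn_integral_cmult) measurable
  also have "?c * \<dots> < \<infinity>"
    using nn_integral_min_kernel_radial_finite[OF s] by (simp add: ennreal_mult_less_top)
  finally show ?thesis .
qed

text \<open>With \<open>K\<close> the set where \<open>u\<close> does not vanish, the increment \<open>\<bar>u x - u y\<bar>\<close> is at most
  \<open>A * min 1 (norm (x - y))\<close> and is zero unless \<open>x \<in> K\<close> or \<open>y \<in> K\<close>. Each of the two cases
  contributes at most \<open>A\<close> times the volume of \<open>K\<close> times the integral of the kernel.\<close>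

lemma gagliardo_smooth_finite:
  fixes u :: "'a::euclidean_space \<Rightarrow> real"
  assumes s: "0 < s" "s < 1" and u: "smooth u" "bounded {x. u x \<noteq> 0}"
  shows "gagliardo s u < \<infinity>"
proof -
  obtain M where M: "0 \<le> M" "\<And>x. \<bar>u x\<bar> \<le> M" using smooth_bounded[OF u] by metis
  obtain L where L: "0 \<le> L" "\<And>x h. \<bar>u (x + h) - u x\<bar> \<le> L * norm h" using smooth_lipschitz[OF u] by metis
  define A where "A = max (2 * M) L"
  define K where "K = {x. u x \<noteq> 0}"
  have cont: "continuous_on UNIV u" by (rule smooth_continuous[OF u(1)])
  have [measurable]: "K \<in> sets borel" unfolding K_def
    by (intro borel_open open_Collect_neq cont continuous_on_const)
  have K: "emeasure lborel K < \<infinity>"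
    unfolding K_def by (rule emeasure_bounded_finite[OF u(2)])
  let ?\<Phi> = "\<lambda>z::'a. ennreal (min 1 (norm z) * gagliardo_kernel s z)"
  have diff: "\<bar>u x - u y\<bar> \<le> A * min 1 (norm (x - y))" for x y
  proof -
    have "\<bar>u x - u y\<bar> \<le> L * norm (x - y)" using L(2)[of y "x - y"] by simp
    also have "\<dots> \<le> A * norm (x - y)" by (intro mult_right_mono) (auto simp: A_def)
    finally have 1: "\<bar>u x - u y\<bar> \<le> A * norm (x - y)" .
    have "\<bar>u x - u y\<bar> \<le> A" using M(2)[of x] M(2)[of y] by (auto simp: A_def)
    with 1 show ?thesis by (cases "1 \<le> norm (x - y)") (simp_all add: min_def)
  qed
  have "gagliardo s u \<le> (\<integral>\<^sup>+ y. (\<integral>\<^sup>+ x. ennreal A * (indicator K x * ?\<Phi> (x - y)) + ennreal A * (indicator K y * ?\<Phi> (x - y)) \<partial>lborel) \<partial>lborel)"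
    unfolding gagliardo_lborel
  proof (intro nn_integral_mono)
    fix x y
    have "ennreal \<bar>u x - u y\<bar> * ennreal (gagliardo_kernel s (x - y)) \<le> ennreal (A * min 1 (norm (x - y))) * ennreal (gagliardo_kernel s (x - y))"
      by (intro mult_right_mono ennreal_leI diff) simp
    also have "\<dots> = ennreal A * ?\<Phi> (x - y)"
      using M(1) by (simp add: ennreal_mult[symmetric] A_def)
    finally have "ennreal \<bar>u x - u y\<bar> * ennreal (gagliardo_kernel s (x - y)) \<le> ennreal A * ?\<Phi> (x - y)" .
    then show "ennreal \<bar>u x - u y\<bar> * ennreal (gagliardo_kernel s (x - y))
        \<le> ennreal A * (indicator K x * ?\<Phi> (x - y)) + ennreal A * (indicator K y * ?\<Phi> (x - y))"
      by (cases "x \<in> K"; cases "y \<in> K") (simp_all add: K_def add_increasing2)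
  qed
  also have "\<dots> = (\<integral>\<^sup>+ y. (\<integral>\<^sup>+ x. ennreal A * (indicator K x * ?\<Phi> (x - y)) \<partial>lborel) \<partial>lborel)
      + (\<integral>\<^sup>+ y. (\<integral>\<^sup>+ x. ennreal A * (indicator K y * ?\<Phi> (x - y)) \<partial>lborel) \<partial>lborel)"
    by (simp add: nn_integral_add)
  also have "(\<integral>\<^sup>+ y. (\<integral>\<^sup>+ x. ennreal A * (indicator K x * ?\<Phi> (x - y)) \<partial>lborel) \<partial>lborel)
      = (\<integral>\<^sup>+ x. (\<integral>\<^sup>+ y. ennreal A * (indicator K x * ?\<Phi> (x - y)) \<partial>lborel) \<partial>lborel)"
    by (subst lborel_pair.Fubini') (simp_all add: split_beta')
  also have "\<dots> = ennreal A * (emeasure lborel K * (\<integral>\<^sup>+ z. ?\<Phi> z \<partial>lborel))"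
    using nn_integral_lborel_reflect[of ?\<Phi> x for x]
    by (simp add: nn_integral_cmult nn_integral_multc)
  also have "(\<integral>\<^sup>+ y. (\<integral>\<^sup>+ x. ennreal A * (indicator K y * ?\<Phi> (x - y)) \<partial>lborel) \<partial>lborel)
      = ennreal A * (emeasure lborel K * (\<integral>\<^sup>+ z. ?\<Phi> z \<partial>lborel))"
    using nn_integral_lborel_shift[of ?\<Phi> "- y" for y]
    by (simp add: nn_integral_cmult nn_integral_multc)
  also have "ennreal A * (emeasure lborel K * (\<integral>\<^sup>+ z. ?\<Phi> z \<partial>lborel)) + ennreal A * (emeasure lborel K * (\<integral>\<^sup>+ z. ?\<Phi> z \<partial>lborel)) < \<infinity>"
    using K nn_integral_min_kernel_finite[OF s, where 'a = 'a] by (simp add: ennreal_mult_less_top)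
  finally show ?thesis .
qed

section \<open>Energy and weighted mass of the smoothed indicator\<close>

text \<open>In this form the convolution is a \<open>\<rho>\<close>-weighted average of translates of the indicator of
  \<open>E\<close>.\<close>

lemma ennreal_mollify:
  fixes \<rho> :: "'a::euclidean_space \<Rightarrow> real"
  assumes \<rho>: "smooth \<rho>" "bounded {x. \<rho> x \<noteq> 0}" "\<And>x. 0 \<le> \<rho> x"
    and E: "E \<in> sets borel" "emeasure lborel E < \<infinity>"
  shows "ennreal (mollify E \<rho> x) = (\<integral>\<^sup>+ z. ennreal (\<rho> z) * indicator E (x - z) \<partial>lborel)"
proof -
  have [measurable]: "\<rho> \<in> borel_measurable borel"
    by (intro borel_measurable_continuous_onI smooth_continuous \<rho>)
  note [measurable] = E(1)
  have "ennreal (mollify E \<rho> x) = (\<integral>\<^sup>+ y. ennreal (indicator E y *\<^sub>R \<rho> (x - y)) \<partial>lborel)"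
    unfolding mollify_def set_lebesgue_integral_def
    using mollify_integrable[OF \<rho>(1,2) E, of x] \<rho>(3)
    by (subst nn_integral_eq_integral) (auto simp: set_integrable_def)
  also have "\<dots> = (\<integral>\<^sup>+ y. (\<lambda>z. ennreal (\<rho> z) * indicator E (x - z)) (x - y) \<partial>lborel)"
    by (intro nn_integral_cong) (auto simp: indicator_def)
  also have "\<dots> = (\<integral>\<^sup>+ z. ennreal (\<rho> z) * indicator E (x - z) \<partial>lborel)"
    by (rule nn_integral_lborel_reflect) measurable
  finally show ?thesis .
qed

lemma mollify_nonneg: "(\<And>x. 0 \<le> \<rho> x) \<Longrightarrow> 0 \<le> mollify E \<rho> x"
  unfolding mollify_def set_lebesgue_integral_def by (intro integral_nonneg_AE) auto

text \<open>Lets a difference of two real integrals be estimated by comparing extended integrals, where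
  no integrability has to be checked.\<close>

lemma ennreal_abs_diff_le:
  assumes "0 \<le> a" "0 \<le> b" "ennreal a \<le> ennreal b + D" "ennreal b \<le> ennreal a + D"
  shows "ennreal \<bar>a - b\<bar> \<le> D"
  using assms by (cases D) (auto simp: ennreal_plus[symmetric] abs_le_iff simp del: ennreal_plus)

text \<open>Minkowski's inequality: the seminorm of an average of translates is at most the average of
  the seminorms, which all coincide by translation invariance. The factor in front is the mass
  of \<open>\<rho>\<close>.\<close>

lemma gagliardo_mollify_le:
  fixes \<rho> :: "'a::euclidean_space \<Rightarrow> real"
  assumes \<rho>: "smooth \<rho>" "bounded {x. \<rho> x \<noteq> 0}" "\<And>x. 0 \<le> \<rho> x"
    and E: "E \<in> sets borel" "emeasure lborel E < \<infinity>"
  shows "gagliardo s (mollify E \<rho>) \<le> (\<integral>\<^sup>+ z. ennreal (\<rho> z) \<partial>lborel) * frac_perimeter s E"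
proof -
  have [measurable]: "\<rho> \<in> borel_measurable borel"
    by (intro borel_measurable_continuous_onI smooth_continuous \<rho>)
  note [measurable] = E(1)
  define d where "d = (\<lambda>x y. ennreal \<bar>indicator E x - indicator E y :: real\<bar>)"
  have [measurable]: "(\<lambda>w. d (f w) (g w)) \<in> borel_measurable N"
    if [measurable]: "f \<in> borel_measurable N" "g \<in> borel_measurable N" for N :: "'b measure" and f g
    unfolding d_def by measurable
  let ?k = "\<lambda>x y. ennreal (gagliardo_kernel s (x - y :: 'a))"
  have le: "ennreal (mollify E \<rho> x) \<le> ennreal (mollify E \<rho> y) + (\<integral>\<^sup>+ z. ennreal (\<rho> z) * d (x - z) (y - z) \<partial>lborel)" for x y
    unfolding ennreal_mollify[OF \<rho> E]
    by (subst nn_integral_add[symmetric]) (auto simp: d_def indicator_def intro!: nn_integral_mono)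
  have d_commute: "d x y = d y x" for x y by (simp add: d_def abs_minus_commute)
  have diff: "ennreal \<bar>mollify E \<rho> x - mollify E \<rho> y\<bar> \<le> (\<integral>\<^sup>+ z. ennreal (\<rho> z) * d (x - z) (y - z) \<partial>lborel)" for x y
    using le[of x y] le[of y x] by (intro ennreal_abs_diff_le mollify_nonneg \<rho>) (simp_all add: d_commute)
  have "gagliardo s (mollify E \<rho>) \<le> (\<integral>\<^sup>+ y. (\<integral>\<^sup>+ x. (\<integral>\<^sup>+ z. ennreal (\<rho> z) * d (x - z) (y - z) \<partial>lborel) * ?k x y \<partial>lborel) \<partial>lborel)"
    unfolding gagliardo_lborel by (intro nn_integral_mono mult_right_mono diff) simp
  also have "\<dots> = (\<integral>\<^sup>+ y. (\<integral>\<^sup>+ x. (\<integral>\<^sup>+ z. ennreal (\<rho> z) * (d (x - z) (y - z) * ?k x y) \<partial>lborel) \<partial>lborel) \<partial>lborel)"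
    by (simp add: nn_integral_multc[symmetric] mult.assoc)
  also have "\<dots> = (\<integral>\<^sup>+ y. (\<integral>\<^sup>+ z. (\<integral>\<^sup>+ x. ennreal (\<rho> z) * (d (x - z) (y - z) * ?k x y) \<partial>lborel) \<partial>lborel) \<partial>lborel)"
    by (subst lborel_pair.Fubini') (simp_all add: split_beta')
  also have "\<dots> = (\<integral>\<^sup>+ z. (\<integral>\<^sup>+ y. (\<integral>\<^sup>+ x. ennreal (\<rho> z) * (d (x - z) (y - z) * ?k x y) \<partial>lborel) \<partial>lborel) \<partial>lborel)"
    by (subst lborel_pair.Fubini') (simp_all add: split_beta')
  also have "\<dots> = (\<integral>\<^sup>+ z. ennreal (\<rho> z) * (\<integral>\<^sup>+ y. (\<integral>\<^sup>+ x. d (x - z) (y - z) * ?k x y \<partial>lborel) \<partial>lborel) \<partial>lborel)"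
    by (simp add: nn_integral_cmult)
  also have "\<dots> = (\<integral>\<^sup>+ z. ennreal (\<rho> z) * (\<integral>\<^sup>+ y. (\<integral>\<^sup>+ x. d x y * ?k x y \<partial>lborel) \<partial>lborel) \<partial>lborel)"
  proof -
    have "(\<integral>\<^sup>+ y. (\<integral>\<^sup>+ x. d (x - z) (y - z) * ?k x y \<partial>lborel) \<partial>lborel) = (\<integral>\<^sup>+ y. (\<integral>\<^sup>+ x. d x y * ?k x y \<partial>lborel) \<partial>lborel)" for z
    proof -
      have "(\<integral>\<^sup>+ y. (\<integral>\<^sup>+ x. d (x - z) (y - z) * ?k x y \<partial>lborel) \<partial>lborel)
          = (\<integral>\<^sup>+ y. (\<integral>\<^sup>+ x. d (x - z) (z + y - z) * ?k x (z + y) \<partial>lborel) \<partial>lborel)"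
        by (rule nn_integral_lborel_shift[symmetric]) measurable
      also have "\<dots> = (\<integral>\<^sup>+ y. (\<integral>\<^sup>+ x. d (z + x - z) (z + y - z) * ?k (z + x) (z + y) \<partial>lborel) \<partial>lborel)"
        by (intro nn_integral_cong nn_integral_lborel_shift[symmetric]) measurable
      finally show ?thesis by simp
    qed
    then show ?thesis by simp
  qed
  also have "\<dots> = (\<integral>\<^sup>+ z. ennreal (\<rho> z) \<partial>lborel) * frac_perimeter s E"
    unfolding frac_perimeter_def gagliardo_lborel d_def by (rule nn_integral_multc) measurable
  finally show ?thesis .
qed

text \<open>The translation by \<open>z\<close> is moved from the indicator of \<open>E\<close> to the weight \<open>w\<close>.\<close>

lemma weighted_integral_mollify:
  fixes \<rho> :: "'a::euclidean_space \<Rightarrow> real"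
  assumes \<rho>: "smooth \<rho>" "bounded {x. \<rho> x \<noteq> 0}" "\<And>x. 0 \<le> \<rho> x"
    and E: "E \<in> sets borel" "emeasure lborel E < \<infinity>"
    and w [measurable]: "w \<in> borel_measurable borel"
  shows "(\<integral>\<^sup>+ x. ennreal (mollify E \<rho> x) * w x \<partial>lborel)
     = (\<integral>\<^sup>+ z. ennreal (\<rho> z) * (\<integral>\<^sup>+ y\<in>E. w (z + y) \<partial>lborel) \<partial>lborel)"
proof -
  have [measurable]: "\<rho> \<in> borel_measurable borel"
    by (intro borel_measurable_continuous_onI smooth_continuous \<rho>)
  note [measurable] = E(1)
  have "(\<integral>\<^sup>+ x. ennreal (mollify E \<rho> x) * w x \<partial>lborel)
      = (\<integral>\<^sup>+ x. (\<integral>\<^sup>+ z. ennreal (\<rho> z) * (indicator E (x - z) * w x) \<partial>lborel) \<partial>lborel)"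
    unfolding ennreal_mollify[OF \<rho> E] by (simp add: nn_integral_multc[symmetric] mult.assoc)
  also have "\<dots> = (\<integral>\<^sup>+ z. (\<integral>\<^sup>+ x. ennreal (\<rho> z) * (indicator E (x - z) * w x) \<partial>lborel) \<partial>lborel)"
    by (subst lborel_pair.Fubini') (simp_all add: split_beta')
  also have "\<dots> = (\<integral>\<^sup>+ z. ennreal (\<rho> z) * (\<integral>\<^sup>+ x. indicator E (x - z) * w x \<partial>lborel) \<partial>lborel)"
    by (simp add: nn_integral_cmult)
  also have "\<dots> = (\<integral>\<^sup>+ z. ennreal (\<rho> z) * (\<integral>\<^sup>+ y\<in>E. w (z + y) \<partial>lborel) \<partial>lborel)"
    using nn_integral_lborel_shift[of "\<lambda>x. indicator E (x - z) * w x" z for z]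
    by (simp add: mult.commute)
  finally show ?thesis .
qed

section \<open>Test functions and the Hardy quotient\<close>

lemma gagliardo_cmult:
  fixes u :: "'a::euclidean_space \<Rightarrow> real"
  assumes [measurable]: "u \<in> borel_measurable borel"
  shows "gagliardo s (\<lambda>x. a * u x) = ennreal \<bar>a\<bar> * gagliardo s u"
  unfolding gagliardo_lborel
  by (simp add: right_diff_distrib[symmetric] abs_mult ennreal_mult mult.assoc nn_integral_cmult)

lemma bdist_pos:
  assumes "open \<Omega>" "\<Omega> \<noteq> UNIV" "x \<in> \<Omega>"
  shows "0 < bdist \<Omega> x"
proof -
  have "frontier \<Omega> \<noteq> {}" using assms by (auto simp: frontier_eq_empty)
  moreover have "x \<notin> frontier \<Omega>" using assms by (simp add: frontier_def interior_open)
  ultimately show ?thesis unfolding bdist_def by (intro infdist_pos_not_in_closed frontier_closed)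
qed

lemma bdist_ge_radius:
  assumes "open \<Omega>" "\<Omega> \<noteq> UNIV" "ball x r \<subseteq> \<Omega>" "0 < r"
  shows "r \<le> bdist \<Omega> x"
proof -
  have "x \<in> \<Omega>" using assms(3,4) by auto
  then have "frontier \<Omega> \<noteq> {}" using assms(2) by (auto simp: frontier_eq_empty)
  moreover have "r \<le> dist x y" if "y \<in> frontier \<Omega>" for y
    using that assms(1,3) by (force simp: frontier_def interior_open)
  ultimately show ?thesis
    unfolding bdist_def infdist_def by (auto intro: cINF_greatest)
qed

lemma bdist_triangle: "bdist \<Omega> (z + y) \<le> bdist \<Omega> y + norm z"
  using infdist_triangle[of "z + y" "frontier \<Omega>" y] by (simp add: bdist_def dist_norm)

lemma weighted_integral_test_function_finite:
  assumes \<Omega>: "open \<Omega>" "\<Omega> \<noteq> UNIV" and u: "u \<in> test_functions \<Omega>"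
  shows "(\<integral>\<^sup>+ x\<in>\<Omega>. ennreal (\<bar>u x\<bar> / bdist \<Omega> x powr s) \<partial>lebesgue) < \<infinity>"
proof -
  define K where "K = closure {x. u x \<noteq> 0}"
  have K: "compact K" "K \<subseteq> \<Omega>" using u by (auto simp: test_functions_def K_def)
  have "continuous_on K (\<lambda>x. \<bar>u x\<bar> / bdist \<Omega> x powr s)"
    using bdist_pos[OF \<Omega>] K(2) unfolding bdist_def
    by (intro continuous_intros continuous_on_subset[OF test_function_continuous[OF u]]) force+
  from compact_continuous_image[OF this K(1)]
  have "\<exists>M. \<forall>x\<in>K. \<bar>u x\<bar> / bdist \<Omega> x powr s \<le> M"
    by (auto dest!: compact_imp_bounded simp: bounded_iff)
  then obtain M where M: "\<And>x. x \<in> K \<Longrightarrow> \<bar>u x\<bar> / bdist \<Omega> x powr s \<le> M" by blast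
  have "(\<integral>\<^sup>+ x\<in>\<Omega>. ennreal (\<bar>u x\<bar> / bdist \<Omega> x powr s) \<partial>lebesgue) \<le> (\<integral>\<^sup>+ x. ennreal M * indicator K x \<partial>lborel)"
    unfolding nn_integral_completion
  proof (intro nn_integral_mono)
    fix x
    have "u x = 0" if "x \<notin> K" using that closure_subset[of "{x. u x \<noteq> 0}"] by (auto simp: K_def)
    then show "ennreal (\<bar>u x\<bar> / bdist \<Omega> x powr s) * indicator \<Omega> x \<le> ennreal M * indicator K x"
      using M[of x] by (cases "x \<in> K") (auto simp: indicator_def intro: ennreal_leI)
  qed
  also have "\<dots> = ennreal M * emeasure lborel K"
    using K(1) by (intro nn_integral_cmult_indicator) (simp add: compact_imp_closed)
  also have "\<dots> < \<infinity>"
    using emeasure_bounded_finite[OF compact_imp_bounded[OF K(1)]] by (simp add: ennreal_mult_less_top)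
  finally show ?thesis .
qed

text \<open>Scaling removes the normalisation of the weighted integral, since both sides are
  positively homogeneous of degree one in \<open>u\<close>.\<close>

lemma hardy_const_mult_integral_le_gagliardo:
  assumes \<Omega>: "open \<Omega>" "\<Omega> \<noteq> UNIV" and u: "u \<in> test_functions \<Omega>"
    and pos: "(\<integral>\<^sup>+ x\<in>\<Omega>. ennreal (\<bar>u x\<bar> / bdist \<Omega> x powr s) \<partial>lebesgue) \<noteq> 0"
  shows "hardy_const s \<Omega> * (\<integral>\<^sup>+ x\<in>\<Omega>. ennreal (\<bar>u x\<bar> / bdist \<Omega> x powr s) \<partial>lebesgue) \<le> gagliardo s u"
proof -
  let ?I = "\<lambda>u. (\<integral>\<^sup>+ x\<in>\<Omega>. ennreal (\<bar>u x\<bar> / bdist \<Omega> x powr s) \<partial>lebesgue)"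
  obtain c where c: "?I u = ennreal c" "0 < c"
    using pos weighted_integral_test_function_finite[OF \<Omega> u, of s]
    by (cases "?I u") (auto simp: less_le)
  have [measurable]: "u \<in> borel_measurable borel"
    by (intro borel_measurable_continuous_onI test_function_continuous[OF u])
  have [measurable]: "\<Omega> \<in> sets borel" using \<Omega>(1) by auto
  define v where "v = (\<lambda>x. 1 / c * u x)"
  have "{x. v x \<noteq> 0} = {x. u x \<noteq> 0}" using c(2) by (auto simp: v_def)
  then have "v \<in> test_functions \<Omega>"
    using u smooth_cmult[of u "1 / c"] by (simp add: test_functions_def v_def)
  moreover have "?I v = 1"
  proof -
    have "?I v = (\<integral>\<^sup>+ x. ennreal (1 / c) * (ennreal (\<bar>u x\<bar> / bdist \<Omega> x powr s) * indicator \<Omega> x) \<partial>lborel)"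
      unfolding nn_integral_completion using c(2)
      by (intro nn_integral_cong) (auto simp: v_def indicator_def abs_mult ennreal_mult[symmetric])
    also have "\<dots> = ennreal (1 / c) * ?I u"
      unfolding nn_integral_completion by (rule nn_integral_cmult) measurable
    also have "\<dots> = 1" unfolding c(1) using c(2) by (simp add: ennreal_mult[symmetric])
    finally show ?thesis .
  qed
  ultimately have "hardy_const s \<Omega> \<le> gagliardo s v"
    unfolding hardy_const_def by (intro INF_lower) auto
  also have "gagliardo s v = ennreal (1 / c) * gagliardo s u"
    unfolding v_def using c(2) by (subst gagliardo_cmult) auto
  finally have "hardy_const s \<Omega> * ennreal c \<le> ennreal (1 / c) * gagliardo s u * ennreal c"
    by (rule mult_right_mono) simp
  also have "\<dots> = ennreal (1 / c * c) * gagliardo s u"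
    using c(2) by (simp only: ennreal_mult ac_simps less_imp_le divide_nonneg_pos zero_le_one)
  also have "\<dots> = gagliardo s u" using c(2) by simp
  finally show ?thesis unfolding c(1) .
qed

text \<open>The support lies in the sum of \<open>closure E\<close> and a closed ball of radius \<open>e\<close>, which is compact
  and contained in \<open>\<Omega>\<close> as \<open>e < r\<close>.\<close>

lemma mollify_test_function:
  fixes \<rho> :: "'a::euclidean_space \<Rightarrow> real"
  assumes \<rho>: "smooth \<rho>" "\<And>x. \<rho> x \<noteq> 0 \<Longrightarrow> norm x \<le> e" and "e < r"
    and E: "E \<in> sets borel" "compact (closure E)" and tube: "(\<Union>x\<in>closure E. ball x r) \<subseteq> \<Omega>"
  shows "mollify E \<rho> \<in> test_functions \<Omega>"
proof -
  let ?S = "{y + z | y z. y \<in> closure E \<and> z \<in> cball 0 e}"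
  have S: "compact ?S" by (intro compact_sums E compact_cball)
  have "{x. mollify E \<rho> x \<noteq> 0} \<subseteq> ?S"
  proof (rule subsetI, rule ccontr)
    fix x assume x: "x \<in> {x. mollify E \<rho> x \<noteq> 0}" "x \<notin> ?S"
    have "\<rho> (x - y) = 0" if "y \<in> E" for y
    proof (rule ccontr)
      assume "\<rho> (x - y) \<noteq> 0"
      then have "x - y \<in> cball 0 e" using \<rho>(2) by simp
      moreover have "y \<in> closure E" using that closure_subset by blast
      moreover have "x = y + (x - y)" by simp
      ultimately show False using x(2) by blast
    qed
    then have zero: "indicator E y *\<^sub>R \<rho> (x - y) = 0" for y by (simp add: indicator_def)
    have "mollify E \<rho> x = 0"
      by (simp only: mollify_def set_lebesgue_integral_def zero Bochner_Integration.integral_zero)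
    with x(1) show False by simp
  qed
  then have sub: "closure {x. mollify E \<rho> x \<noteq> 0} \<subseteq> ?S"
    by (intro closure_minimal compact_imp_closed S)
  have "y + z \<in> \<Omega>" if "y \<in> closure E" "z \<in> cball 0 e" for y z
  proof -
    have "y + z \<in> ball y r" using that(2) \<open>e < r\<close> by (simp add: dist_norm)
    with tube that(1) show ?thesis by blast
  qed
  then have "?S \<subseteq> \<Omega>" by blast
  moreover have "compact (closure {x. mollify E \<rho> x \<noteq> 0})"
    using compact_Int_closed[OF S closed_closure, of "{x. mollify E \<rho> x \<noteq> 0}"] Int_absorb1[OF sub] by simp
  moreover have "smooth (mollify E \<rho>)"
  proof (rule smooth_mollify[OF \<rho>(1) _ E(1)])
    show "bounded {x. \<rho> x \<noteq> 0}" using \<rho>(2) by (auto simp: bounded_iff)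
    have "bounded E" using E(2) by (meson bounded_subset closure_subset compact_imp_bounded)
    then show "emeasure lborel E < \<infinity>" by (rule emeasure_bounded_finite)
  qed
  ultimately show ?thesis using sub by (auto simp: test_functions_def)
qed

text \<open>A displacement by at most \<open>e\<close> changes \<open>bdist \<Omega> y\<close> by at most \<open>e\<close>, which is at most
  \<open>(e / r) * bdist \<Omega> y\<close> for \<open>y \<in> E\<close>. So the displaced weight is at least
  \<open>(1 + e / r) powr - s\<close> times the weight at \<open>y\<close>, whatever the displacement.\<close>

lemma weighted_integral_mollify_ge:
  fixes \<rho> :: "'a::euclidean_space \<Rightarrow> real"
  assumes \<Omega>: "open \<Omega>" "\<Omega> \<noteq> UNIV" and s: "0 < s"
    and \<rho>: "smooth \<rho>" "\<And>x. 0 \<le> \<rho> x" "\<And>x. \<rho> x \<noteq> 0 \<Longrightarrow> norm x \<le> e" and e: "0 < e" "e < r"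
    and E: "E \<in> sets borel" "bounded E" and tube: "\<And>x. x \<in> E \<Longrightarrow> ball x r \<subseteq> \<Omega>"
  shows "(\<integral>\<^sup>+ z. ennreal (\<rho> z) \<partial>lborel) * (ennreal ((1 + e / r) powr - s) * weighted_volume s \<Omega> E)
    \<le> (\<integral>\<^sup>+ x\<in>\<Omega>. ennreal (\<bar>mollify E \<rho> x\<bar> / bdist \<Omega> x powr s) \<partial>lebesgue)"
proof -
  have [measurable]: "\<rho> \<in> borel_measurable borel"
    by (intro borel_measurable_continuous_onI smooth_continuous \<rho>)
  have [measurable]: "\<Omega> \<in> sets borel" using \<Omega>(1) by auto
  note [measurable] = E(1)
  define w where "w = (\<lambda>x. ennreal (1 / bdist \<Omega> x powr s) * indicator \<Omega> x)"
  have [measurable]: "w \<in> borel_measurable borel" unfolding w_def by measurable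
  let ?q = "(1 + e / r) powr - s"
  have pt: "ennreal ?q * ennreal (1 / bdist \<Omega> y powr s) \<le> w (z + y)" if "\<rho> z \<noteq> 0" "y \<in> E" for z y
  proof -
    have z: "norm z \<le> e" using \<rho>(3) that by blast
    have r: "r \<le> bdist \<Omega> y" using tube[OF that(2)] e by (intro bdist_ge_radius \<Omega>) auto
    have "z + y \<in> ball y r" using z e by (simp add: dist_norm)
    then have in\<Omega>: "z + y \<in> \<Omega>" using tube[OF that(2)] by blast
    have "bdist \<Omega> (z + y) \<le> bdist \<Omega> y + e" using bdist_triangle[of \<Omega> z y] z by simp
    also have "\<dots> \<le> bdist \<Omega> y + e * (bdist \<Omega> y / r)"
      using r e by (simp add: field_simps)
    also have "\<dots> = (1 + e / r) * bdist \<Omega> y" by (simp add: algebra_simps)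
    finally have "((1 + e / r) * bdist \<Omega> y) powr - s \<le> bdist \<Omega> (z + y) powr - s"
      using bdist_pos[OF \<Omega> in\<Omega>] s by (intro powr_mono2') auto
    moreover have "((1 + e / r) * bdist \<Omega> y) powr - s = ?q * (1 / bdist \<Omega> y powr s)"
      using e r by (simp add: powr_mult powr_minus divide_inverse)
    ultimately show ?thesis
      using in\<Omega> by (simp add: w_def ennreal_mult[symmetric] powr_minus_divide ennreal_leI)
  qed
  have "(\<integral>\<^sup>+ z. ennreal (\<rho> z) \<partial>lborel) * (ennreal ?q * weighted_volume s \<Omega> E)
      = (\<integral>\<^sup>+ z. ennreal (\<rho> z) * (ennreal ?q * weighted_volume s \<Omega> E) \<partial>lborel)"
    by (rule nn_integral_multc[symmetric]) measurable
  also have "\<dots> \<le> (\<integral>\<^sup>+ z. ennreal (\<rho> z) * (\<integral>\<^sup>+ y\<in>E. w (z + y) \<partial>lborel) \<partial>lborel)"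
  proof (intro nn_integral_mono)
    fix z
    show "ennreal (\<rho> z) * (ennreal ?q * weighted_volume s \<Omega> E) \<le> ennreal (\<rho> z) * (\<integral>\<^sup>+ y\<in>E. w (z + y) \<partial>lborel)"
    proof (cases "\<rho> z = 0")
      case False
      have "ennreal ?q * weighted_volume s \<Omega> E = (\<integral>\<^sup>+ y. ennreal ?q * (ennreal (1 / bdist \<Omega> y powr s) * indicator E y) \<partial>lborel)"
        unfolding weighted_volume_def nn_integral_completion by (rule nn_integral_cmult[symmetric]) measurable
      also have "\<dots> \<le> (\<integral>\<^sup>+ y\<in>E. w (z + y) \<partial>lborel)"
        using pt[OF False] by (intro nn_integral_mono) (auto simp: indicator_def)
      finally show ?thesis by (rule mult_left_mono) simp
    qed simp
  qed
  also have "\<dots> = (\<integral>\<^sup>+ x. ennreal (mollify E \<rho> x) * w x \<partial>lborel)"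
  proof (rule weighted_integral_mollify[symmetric])
    show "bounded {x. \<rho> x \<noteq> 0}" using \<rho>(3) by (auto simp: bounded_iff)
    show "emeasure lborel E < \<infinity>" using E(2) by (rule emeasure_bounded_finite)
  qed (use \<rho> E in auto)
  also have "\<dots> = (\<integral>\<^sup>+ x\<in>\<Omega>. ennreal (\<bar>mollify E \<rho> x\<bar> / bdist \<Omega> x powr s) \<partial>lebesgue)"
    unfolding nn_integral_completion using mollify_nonneg[of \<rho>, OF \<rho>(2)]
    by (intro nn_integral_cong) (auto simp: w_def indicator_def ennreal_mult[symmetric])
  finally show ?thesis .
qed

lemma weighted_volume_pos:
  assumes \<Omega>: "open \<Omega>" "\<Omega> \<noteq> UNIV" and E: "E \<in> sets borel" "E \<subseteq> \<Omega>" "0 < emeasure lborel E"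
  shows "0 < weighted_volume s \<Omega> E"
proof -
  note [measurable] = E(1)
  have "{x \<in> space lborel. ennreal (1 / bdist \<Omega> x powr s) * indicator E x \<noteq> 0} = E"
    using bdist_pos[OF \<Omega>] E(2) by (force simp: indicator_def)
  then have "weighted_volume s \<Omega> E \<noteq> 0"
    unfolding weighted_volume_def nn_integral_completion using E(3)
    by (subst nn_integral_0_iff) auto
  then show ?thesis by (simp add: zero_less_iff_neq_zero)
qed

lemma weighted_volume_finite:
  assumes \<Omega>: "open \<Omega>" "\<Omega> \<noteq> UNIV" and s: "0 < s" and r: "0 < r"
    and E: "E \<in> sets borel" "bounded E" and tube: "\<And>x. x \<in> E \<Longrightarrow> ball x r \<subseteq> \<Omega>"
  shows "weighted_volume s \<Omega> E < \<infinity>"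
proof -
  have "weighted_volume s \<Omega> E \<le> (\<integral>\<^sup>+ x. ennreal (1 / r powr s) * indicator E x \<partial>lborel)"
    unfolding weighted_volume_def nn_integral_completion
  proof (intro nn_integral_mono)
    fix x
    show "ennreal (1 / bdist \<Omega> x powr s) * indicator E x \<le> ennreal (1 / r powr s) * indicator E x"
    proof (cases "x \<in> E")
      case True
      have "r \<le> bdist \<Omega> x" by (rule bdist_ge_radius[OF \<Omega> tube[OF True] r])
      then have "1 / bdist \<Omega> x powr s \<le> 1 / r powr s"
        using r s by (intro divide_left_mono powr_mono2) auto
      then show ?thesis using True by (simp add: ennreal_leI)
    qed simp
  qed
  also have "\<dots> = ennreal (1 / r powr s) * emeasure lborel E"
    using E by (intro nn_integral_cmult_indicator) simp
  also have "\<dots> < \<infinity>"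
    using emeasure_bounded_finite[OF E(2)] by (simp add: ennreal_mult_less_top)
  finally show ?thesis .
qed

lemma bump_mass:
  fixes \<rho> :: "'a::euclidean_space \<Rightarrow> real"
  assumes \<rho>: "smooth \<rho>" "bounded {x. \<rho> x \<noteq> 0}" "\<And>x. 0 \<le> \<rho> x" "0 < \<rho> 0"
  shows "0 < (\<integral>\<^sup>+ z. ennreal (\<rho> z) \<partial>lborel)" "(\<integral>\<^sup>+ z. ennreal (\<rho> z) \<partial>lborel) < \<infinity>"
proof -
  have cont: "continuous_on UNIV \<rho>" by (rule smooth_continuous[OF \<rho>(1)])
  have [measurable]: "\<rho> \<in> borel_measurable borel" by (intro borel_measurable_continuous_onI cont)
  have op: "open {x. \<rho> x \<noteq> 0}" by (intro open_Collect_neq cont continuous_on_const)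
  have "emeasure lborel {x. \<rho> x \<noteq> 0} > 0" using \<rho>(4) by (intro emeasure_open_pos op) force
  moreover have "{x \<in> space lborel. ennreal (\<rho> x) \<noteq> 0} = {x. \<rho> x \<noteq> 0}"
    using \<rho>(3) by (auto simp: ennreal_eq_0_iff intro: antisym)
  ultimately have "(\<integral>\<^sup>+ z. ennreal (\<rho> z) \<partial>lborel) \<noteq> 0"
    by (subst nn_integral_0_iff) auto
  then show "0 < (\<integral>\<^sup>+ z. ennreal (\<rho> z) \<partial>lborel)" by (simp add: zero_less_iff_neq_zero)
  obtain M where M: "0 \<le> M" "\<And>x. \<bar>\<rho> x\<bar> \<le> M" using smooth_bounded[OF \<rho>(1,2)] by metis
  have "(\<integral>\<^sup>+ z. ennreal (\<rho> z) \<partial>lborel) \<le> (\<integral>\<^sup>+ z. ennreal M * indicator {x. \<rho> x \<noteq> 0} z \<partial>lborel)"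
  proof (intro nn_integral_mono)
    fix z
    have "\<rho> z \<le> M" using M(2)[of z] by linarith
    then show "ennreal (\<rho> z) \<le> ennreal M * indicator {x. \<rho> x \<noteq> 0} z"
      by (cases "\<rho> z = 0") (simp_all add: ennreal_leI)
  qed
  also have "\<dots> = ennreal M * emeasure lborel {x. \<rho> x \<noteq> 0}"
    using op by (intro nn_integral_cmult_indicator) simp
  also have "\<dots> < \<infinity>" using emeasure_bounded_finite[OF \<rho>(2)] by (simp add: ennreal_mult_less_top)
  finally show "(\<integral>\<^sup>+ z. ennreal (\<rho> z) \<partial>lborel) < \<infinity>" .
qed

section \<open>The upper bound for the Hardy constant\<close>

text \<open>The mollified indicator of \<open>E\<close> is the test function for both bounds: the mass of the bump
  appears on both sides and cancels, and the loss \<open>(1 + e / r) powr - s\<close> tends to 1.\<close>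

lemma hardy_const_bounds_from_borel_set:
  fixes E :: "'a::euclidean_space set"
  assumes \<Omega>: "open \<Omega>" "\<Omega> \<noteq> UNIV" and s: "0 < s" "s < 1"
    and E: "E \<in> sets borel" "compact (closure E)" "closure E \<subseteq> \<Omega>" "0 < emeasure lborel E"
  shows "hardy_const s \<Omega> * weighted_volume s \<Omega> E \<le> frac_perimeter s E"
    and "hardy_const s \<Omega> < \<infinity>"
    and "0 < weighted_volume s \<Omega> E" "weighted_volume s \<Omega> E < \<infinity>"
proof -
  let ?h = "hardy_const s \<Omega>" and ?V = "weighted_volume s \<Omega> E" and ?P = "frac_perimeter s E"
  obtain r where r: "0 < r" and tube: "(\<Union>x\<in>closure E. ball x r) \<subseteq> \<Omega>"
    using compact_subset_open_imp_ball_epsilon_subset[OF E(2) \<Omega>(1) E(3)] by blast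
  have tube': "ball x r \<subseteq> \<Omega>" if "x \<in> E" for x using tube that closure_subset by blast
  have bdd: "bounded E" using E(2) by (meson bounded_subset closure_subset compact_imp_bounded)
  have fin: "emeasure lborel E < \<infinity>" by (rule emeasure_bounded_finite[OF bdd])
  show V0: "0 < ?V" using E closure_subset by (intro weighted_volume_pos \<Omega>) auto
  show Vfin: "?V < \<infinity>" by (rule weighted_volume_finite[OF \<Omega> s(1) r E(1) bdd tube'])
  have step: "ennreal ((1 + e / r) powr - s) * (?h * ?V) \<le> ?P \<and> ?h < \<infinity>" if e: "0 < e" "e < r" for e
  proof -
    let ?q = "ennreal ((1 + e / r) powr - s)"
    obtain \<rho> :: "'a \<Rightarrow> real" where \<rho>: "smooth \<rho>" "\<And>x. 0 \<le> \<rho> x" "0 < \<rho> 0" "\<And>x. \<rho> x \<noteq> 0 \<Longrightarrow> norm x \<le> e"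
      using smooth_bump_exists[OF e(1)] by metis
    have supp: "bounded {x. \<rho> x \<noteq> 0}" using \<rho>(4) by (auto simp: bounded_iff)
    let ?m = "\<integral>\<^sup>+ z. ennreal (\<rho> z) \<partial>lborel" and ?u = "mollify E \<rho>"
    let ?I = "\<integral>\<^sup>+ x\<in>\<Omega>. ennreal (\<bar>?u x\<bar> / bdist \<Omega> x powr s) \<partial>lebesgue"
    note m = bump_mass[OF \<rho>(1) supp \<rho>(2,3)]
    have u: "?u \<in> test_functions \<Omega>" by (rule mollify_test_function[OF \<rho>(1,4) e(2) E(1,2) tube])
    have I: "?m * (?q * ?V) \<le> ?I"
      by (rule weighted_integral_mollify_ge[OF \<Omega> s(1) \<rho>(1,2,4) e E(1) bdd tube'])
    have "0 < ?m * (?q * ?V)"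
      using m(1) V0 add_pos_pos[OF zero_less_one divide_pos_pos[OF e(1) r]]
      by (simp add: ennreal_zero_less_mult_iff)
    with I have I0: "?I \<noteq> 0" by auto
    have hI: "?h * ?I \<le> gagliardo s ?u" by (rule hardy_const_mult_integral_le_gagliardo[OF \<Omega> u I0])
    have "?m * (?q * (?h * ?V)) = ?h * (?m * (?q * ?V))" by (simp only: ac_simps)
    also have "\<dots> \<le> ?h * ?I" by (rule mult_left_mono[OF I]) simp
    also note hI
    also have "gagliardo s ?u \<le> ?m * ?P" by (rule gagliardo_mollify_le[OF \<rho>(1) supp \<rho>(2) E(1) fin])
    finally have "?q * (?h * ?V) \<le> ?P"
      using m by (simp add: ennreal_mult_le_mult_iff)
    moreover have "gagliardo s ?u < \<infinity>"
      using u compact_imp_bounded[of "closure {x. ?u x \<noteq> 0}"] closure_subset bounded_subset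
      by (intro gagliardo_smooth_finite s) (auto simp: test_functions_def)
    with hI have "?h * ?I < \<infinity>" by (rule le_less_trans)
    with I0 have "?h < \<infinity>" by (auto simp: ennreal_mult_less_top)
    ultimately show ?thesis by blast
  qed
  show "?h < \<infinity>" using step[of "r / 2"] r by simp
  have "((\<lambda>e. (1 + e / r) powr - s) \<longlongrightarrow> (1 + 0 / r) powr - s) (at_right 0)"
    using r by (intro tendsto_intros) auto
  then have "((\<lambda>e. ennreal ((1 + e / r) powr - s) * (?h * ?V)) \<longlongrightarrow> ennreal 1 * (?h * ?V)) (at_right 0)"
    using tendsto_mult_ennreal[OF tendsto_ennrealI tendsto_const[of "?h * ?V"]] by fastforce
  moreover have "\<forall>\<^sub>F e in at_right 0. ennreal ((1 + e / r) powr - s) * (?h * ?V) \<le> ?P"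
    unfolding eventually_at_right_field using step r by (intro exI[of _ r]) simp
  ultimately have "ennreal 1 * (?h * ?V) \<le> ?P"
    by (rule tendsto_upperbound) simp
  then show "?h * ?V \<le> ?P" by simp
qed

text \<open>Tonelli's theorem needs Borel sets. A representative inside \<open>E\<close> keeps its closure in \<open>closure E\<close>,
  hence in \<open>\<Omega>\<close>.\<close>

lemma lebesgue_set_borel_representative:
  fixes E :: "'a::euclidean_space set"
  assumes "E \<in> sets lebesgue"
  obtains B where "B \<in> sets borel" "B \<subseteq> E" "AE x in lborel. x \<in> B \<longleftrightarrow> x \<in> E"
proof -
  obtain B N N' where BN: "E = B \<union> N" "N \<subseteq> N'" "N' \<in> null_sets lborel" "B \<in> sets lborel"
    using sets_completionE[OF assms] by metis
  have "AE x in lborel. x \<in> B \<longleftrightarrow> x \<in> E"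
    by (rule AE_I'[OF BN(3)]) (use BN in auto)
  with BN show ?thesis by (intro that[of B]) auto
qed

lemma frac_perimeter_cong_AE:
  fixes E :: "'a::euclidean_space set"
  assumes "AE x in lborel. x \<in> B \<longleftrightarrow> x \<in> E"
  shows "frac_perimeter s B = frac_perimeter s E"
proof -
  have ind: "AE x in lborel. (indicator B x :: real) = indicator E x"
    using assms by eventually_elim (auto simp: indicator_def)
  show ?thesis
    unfolding frac_perimeter_def gagliardo_lborel
  proof (rule nn_integral_cong_AE, use ind in eventually_elim)
    fix y assume y: "(indicator B y :: real) = indicator E y"
    show "(\<integral>\<^sup>+ x. ennreal \<bar>indicator B x - indicator B y\<bar> * ennreal (gagliardo_kernel s (x - y)) \<partial>lborel)
        = (\<integral>\<^sup>+ x. ennreal \<bar>indicator E x - indicator E y\<bar> * ennreal (gagliardo_kernel s (x - y)) \<partial>lborel)"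
      by (rule nn_integral_cong_AE, use ind in eventually_elim) (simp add: y)
  qed
qed

lemma weighted_volume_cong_AE:
  assumes "AE x in lborel. x \<in> B \<longleftrightarrow> x \<in> E"
  shows "weighted_volume s \<Omega> B = weighted_volume s \<Omega> E"
  unfolding weighted_volume_def nn_integral_completion
  by (rule nn_integral_cong_AE, use assms in eventually_elim) (simp add: indicator_def)

lemma hardy_const_le_cheeger_quotient:
  fixes E :: "'a::euclidean_space set"
  assumes \<Omega>: "open \<Omega>" "\<Omega> \<noteq> UNIV" and s: "0 < s" "s < 1"
    and E: "compactly_inside E \<Omega>" "0 < emeasure lebesgue E"
  shows "hardy_const s \<Omega> \<le> frac_perimeter s E / weighted_volume s \<Omega> E"
proof -
  have E': "E \<in> sets lebesgue" "compact (closure E)" "closure E \<subseteq> \<Omega>"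
    using E(1) by (auto simp: compactly_inside_def)
  obtain B where B: "B \<in> sets borel" "B \<subseteq> E" "AE x in lborel. x \<in> B \<longleftrightarrow> x \<in> E"
    using lebesgue_set_borel_representative[OF E'(1)] by metis
  have cl: "closure B \<subseteq> closure E" by (rule closure_mono[OF B(2)])
  then have c: "compact (closure B)" using compact_Int_closed[OF E'(2), of "closure B"]
    by (simp add: Int_absorb1)
  have "emeasure lebesgue B = emeasure lebesgue E"
    using B E'(1) AE_completion[OF B(3)] by (intro emeasure_eq_AE) auto
  then have pos: "0 < emeasure lborel B" using E(2) B(1) by simp
  note * = hardy_const_bounds_from_borel_set[OF \<Omega> s B(1) c _ pos]
  have sub: "closure B \<subseteq> \<Omega>" using cl E'(3) by blast
  have "hardy_const s \<Omega> = hardy_const s \<Omega> * weighted_volume s \<Omega> B / weighted_volume s \<Omega> B"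
    using *(3,4)[OF sub] by (intro ennreal_mult_divide_eq[symmetric]) auto
  also have "\<dots> \<le> frac_perimeter s B / weighted_volume s \<Omega> B"
    by (rule divide_right_mono_ennreal[OF *(1)[OF sub]])
  finally show ?thesis
    by (simp add: frac_perimeter_cong_AE[OF B(3)] weighted_volume_cong_AE[OF B(3)])
qed

lemma hardy_const_finite:
  fixes \<Omega> :: "'a::euclidean_space set"
  assumes \<Omega>: "open \<Omega>" "\<Omega> \<noteq> {}" "\<Omega> \<noteq> UNIV" and s: "0 < s" "s < 1"
  shows "hardy_const s \<Omega> < \<infinity>"
proof -
  obtain x where "x \<in> \<Omega>" using \<Omega>(2) by blast
  then obtain r where r: "0 < r" "cball x r \<subseteq> \<Omega>" using \<Omega>(1) open_contains_cball by blast
  show ?thesis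
  proof (rule hardy_const_bounds_from_borel_set(2)[OF \<Omega>(1,3) s])
    show "0 < emeasure lborel (ball x r)" using r by (intro emeasure_open_pos) auto
  qed (use r in auto)
qed

theorem theorem1p4:
  fixes s :: real and \<Omega> :: "(real ^ 'n) set"
  assumes "0 < s" and "s < 1"
    and "open \<Omega>" and "\<Omega> \<noteq> {}" and "\<Omega> \<noteq> UNIV"
  shows "hardy_const s \<Omega> = cheeger_const s \<Omega> \<and> cheeger_const s \<Omega> < \<infinity>"
proof -
  have "hardy_const s \<Omega> \<le> cheeger_const s \<Omega>"
    unfolding cheeger_const_def
    using hardy_const_le_cheeger_quotient[OF assms(3,5,1,2)] by (intro INF_greatest) auto
  then have "hardy_const s \<Omega> = cheeger_const s \<Omega>"
    using cheeger_const_le_hardy_const by (rule antisym)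
  with hardy_const_finite[OF assms(3-5,1,2)] show ?thesis by simp
qed

end
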